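(* For all $1\le u,v\le\infty$, one has $$A^{\mathrm{rd}}_1(u,v)=\max\Bigl\{\frac1v,\ 1-\frac1u,\ \frac{2}{v}-\frac1u,\ 1+\frac{2}{v}-\frac{3}{u}\Bigr\},$$ where $A^{\mathrm{rd}}_1(u,v)$ is the smallest non-negative real number, independent of the field size $q$, for which there exists a constant $C_{u,v}>0$ (independent of $q$) with $$\|\mathcal{M}^{\mathrm{rd}}_{\mathbb{H}_1}F\|_{\ell^v(\mathcal{D}_1)}\le C_{u,v}\,q^{A^{\mathrm{rd}}_1(u,v)}\,\|F\|_{\ell^u(\mathbb{H}_1(\mathbb{F}_q))}$$ for all odd prime powers $q$ and all $F:\mathbb{H}_1(\mathbb{F}_q)\to\mathbb{C}$.
   Context: $q$ ranges over odd prime powers and $\mathbb{F}_q$ is the field with $q$ elements. The Heisenberg group $\mathbb{H}_1(\mathbb{F}_q)$ is the set $\mathbb{F}_q^3$ with group law $(x,y,t)\cdot(x',y',t')=(x+x',\,y+y',\,t+t'+(xy'-yx'))$. A horizontal line is a set of the form $\{(x_0,y_0,t_0)\cdot(sa,sb,0):s\in\mathbb{F}_q\}=\{(x_0+sa,\,y_0+sb,\,t_0+s(x_0b-y_0a)):s\in\mathbb{F}_q\}$ with $(x_0,y_0,t_0)\in\mathbb{H}_1(\mathbb{F}_q)$ and $(a,b)\in\mathbb{F}_q^2\setminus\{(0,0)\}$. The refined direction set is $\mathcal{D}_1=\{[a:b:c]\in\mathbb{P}^2(\mathbb{F}_q):(a,b)\ne(0,0)\}$. The refined direction of the horizontal line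 $L$ above is $\mathrm{Dir}(L)=[a:b:x_0b-y_0a]\in\mathcal{D}_1$ (this does not depend on the choice of the point $(x_0,y_0,t_0)\in L$ or of the representative $(a,b)$). For $F:\mathbb{H}_1(\mathbb{F}_q)\to\mathbb{C}$, $$(\mathcal{M}^{\mathrm{rd}}_{\mathbb{H}_1}F)(\omega):=\max_{\substack{L\ \text{horizontal}\\ \mathrm{Dir}(L)=\omega}}\ \sum_{\mathbf{p}\in L}|F(\mathbf{p})|,\qquad\omega\in\mathcal{D}_1.$$ For a finite set $X$, $\ell^p(X)$ is the space of complex-valued functions on $X$ with the $\ell^p$-norm with respect to counting measure. Convention: $1/\infty=0$. *)

theory Defs
  imports
    "HOL-Library.Extended_Nonnegative_Real"
    "HOL-Number_Theory.Prime_Powers"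
    "HOL-Algebra.Weak_Morphisms"
begin

section \<open>The Heisenberg group over a finite field\<close>

definition heis :: "('a, 'b) ring_scheme \<Rightarrow> ('a \<times> 'a \<times> 'a) monoid" where
  "heis R =
     \<lparr>carrier = carrier R \<times> carrier R \<times> carrier R,
      mult = (\<lambda>(x, y, t) (x', y', t').
        (x \<oplus>\<^bsub>R\<^esub> x', y \<oplus>\<^bsub>R\<^esub> y',
         t \<oplus>\<^bsub>R\<^esub> t' \<oplus>\<^bsub>R\<^esub> (x \<otimes>\<^bsub>R\<^esub> y' \<ominus>\<^bsub>R\<^esub> y \<otimes>\<^bsub>R\<^esub> x'))),
      one = (\<zero>\<^bsub>R\<^esub>, \<zero>\<^bsub>R\<^esub>, \<zero>\<^bsub>R\<^esub>)\<rparr>"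

definition hline ::
  "('a, 'b) ring_scheme \<Rightarrow> 'a \<times> 'a \<times> 'a \<Rightarrow> 'a \<Rightarrow> 'a \<Rightarrow> ('a \<times> 'a \<times> 'a) set" where
  "hline R p a b =
     (\<lambda>s. p \<otimes>\<^bsub>heis R\<^esub> (s \<otimes>\<^bsub>R\<^esub> a, s \<otimes>\<^bsub>R\<^esub> b, \<zero>\<^bsub>R\<^esub>)) ` carrier R"

definition nonzero_pairs :: "('a, 'b) ring_scheme \<Rightarrow> ('a \<times> 'a) set" where
  "nonzero_pairs R = carrier R \<times> carrier R - {(\<zero>\<^bsub>R\<^esub>, \<zero>\<^bsub>R\<^esub>)}"

definition horizontal_lines :: "('a, 'b) ring_scheme \<Rightarrow> ('a \<times> 'a \<times> 'a) set set" where
  "horizontal_lines R =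
     {hline R p a b | p a b. p \<in> carrier (heis R) \<and> (a, b) \<in> nonzero_pairs R}"


section \<open>Refined directions\<close>

definition nonzero_triples :: "('a, 'b) ring_scheme \<Rightarrow> ('a \<times> 'a \<times> 'a) set" where
  "nonzero_triples R =
     carrier R \<times> carrier R \<times> carrier R - {(\<zero>\<^bsub>R\<^esub>, \<zero>\<^bsub>R\<^esub>, \<zero>\<^bsub>R\<^esub>)}"

definition proj_rel ::
  "('a, 'b) ring_scheme \<Rightarrow> (('a \<times> 'a \<times> 'a) \<times> ('a \<times> 'a \<times> 'a)) set" where
  "proj_rel R =
     {((a, b, c), (a', b', c')).
        (a, b, c) \<in> nonzero_triples R \<and> (a', b', c') \<in> nonzero_triples R \<and>
        (\<exists>r \<in> carrier R - {\<zero>\<^bsub>R\<^esub>}.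
           a' = r \<otimes>\<^bsub>R\<^esub> a \<and> b' = r \<otimes>\<^bsub>R\<^esub> b \<and> c' = r \<otimes>\<^bsub>R\<^esub> c)}"

definition proj_plane :: "('a, 'b) ring_scheme \<Rightarrow> ('a \<times> 'a \<times> 'a) set set" where
  "proj_plane R = nonzero_triples R // proj_rel R"

text \<open>The point \<open>[a : b : c]\<close> of the projective plane.\<close>

definition proj_point :: "('a, 'b) ring_scheme \<Rightarrow> 'a \<Rightarrow> 'a \<Rightarrow> 'a \<Rightarrow> ('a \<times> 'a \<times> 'a) set" where
  "proj_point R a b c = proj_rel R `` {(a, b, c)}"

definition refined_directions :: "('a, 'b) ring_scheme \<Rightarrow> ('a \<times> 'a \<times> 'a) set set" where
  "refined_directions R =
     {\<omega> \<in> proj_plane R. \<exists>a b c. \<omega> = proj_point R a b c \<and>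
        (a, b) \<in> nonzero_pairs R \<and> c \<in> carrier R}"

text \<open>
  The value does not depend on the parametrisation of the line (\<open>Dir_hline\<close> below), so the
  description is unique for every horizontal line.
\<close>

definition Dir :: "('a, 'b) ring_scheme \<Rightarrow> ('a \<times> 'a \<times> 'a) set \<Rightarrow> ('a \<times> 'a \<times> 'a) set" where
  "Dir R L = (THE \<omega>. \<exists>x\<^sub>0 y\<^sub>0 t\<^sub>0 a b.
     (x\<^sub>0, y\<^sub>0, t\<^sub>0) \<in> carrier (heis R) \<and> (a, b) \<in> nonzero_pairs R \<and>
     L = hline R (x\<^sub>0, y\<^sub>0, t\<^sub>0) a b \<and>
     \<omega> = proj_point R a b (x\<^sub>0 \<otimes>\<^bsub>R\<^esub> b \<ominus>\<^bsub>R\<^esub> y\<^sub>0 \<otimes>\<^bsub>R\<^esub> a))"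

lemma (in cring) heis_step:
  assumes "x \<in> carrier R" "y \<in> carrier R" "t \<in> carrier R"
    and "a \<in> carrier R" "b \<in> carrier R" "s \<in> carrier R"
  shows "(x, y, t) \<otimes>\<^bsub>heis R\<^esub> (s \<otimes> a, s \<otimes> b, \<zero>)
    = (x \<oplus> s \<otimes> a, y \<oplus> s \<otimes> b, t \<oplus> s \<otimes> (x \<otimes> b \<ominus> y \<otimes> a))"
  using assms by (simp add: heis_def) algebra

lemma (in cring) hline_eq:
  assumes "(x, y, t) \<in> carrier (heis R)" "a \<in> carrier R" "b \<in> carrier R"
  shows "hline R (x, y, t) a b =
    {(x \<oplus> s \<otimes> a, y \<oplus> s \<otimes> b, t \<oplus> s \<otimes> (x \<otimes> b \<ominus> y \<otimes> a)) | s. s \<in> carrier R}"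
proof -
  have "x \<in> carrier R" "y \<in> carrier R" "t \<in> carrier R"
    using assms by (simp_all add: heis_def)
  then have "hline R (x, y, t) a b =
      (\<lambda>s. (x \<oplus> s \<otimes> a, y \<oplus> s \<otimes> b, t \<oplus> s \<otimes> (x \<otimes> b \<ominus> y \<otimes> a))) ` carrier R"
    unfolding hline_def using assms(2,3) by (intro image_cong refl heis_step)
  then show ?thesis by (simp only: image_def) blast
qed

lemma (in field) equiv_proj_rel: "equiv (nonzero_triples R) (proj_rel R)"
proof (rule equivI)
  show "refl_on (nonzero_triples R) (proj_rel R)"
    unfolding refl_on_def proj_rel_def nonzero_triples_def
    by (auto intro!: bexI[of _ \<one>])
  show "sym (proj_rel R)"
  proof (rule symI)
    fix p q assume "(p, q) \<in> proj_rel R"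
    then obtain a b c a' b' c' r where *: "p = (a, b, c)" "q = (a', b', c')"
      "p \<in> nonzero_triples R" "q \<in> nonzero_triples R" "r \<in> carrier R" "r \<noteq> \<zero>"
      "a' = r \<otimes> a" "b' = r \<otimes> b" "c' = r \<otimes> c"
      unfolding proj_rel_def by blast
    have "r \<in> Units R" using * by (simp add: field_Units)
    then have "inv r \<in> Units R" by (rule Units_inv_Units)
    then have ir: "inv r \<in> carrier R" "inv r \<noteq> \<zero>"
      unfolding field_Units by blast+
    have abc: "a \<in> carrier R" "b \<in> carrier R" "c \<in> carrier R"
      using * by (auto simp: nonzero_triples_def)
    have "inv r \<otimes> (r \<otimes> z) = z" if "z \<in> carrier R" for z
      using that * ir by (simp add: m_assoc[symmetric] field_Units)
    then have "a = inv r \<otimes> a'" "b = inv r \<otimes> b'" "c = inv r \<otimes> c'"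
      using *(7-9) abc by simp_all
    then show "(q, p) \<in> proj_rel R"
      using *(1-4) ir unfolding proj_rel_def by blast
  qed
  show "trans (proj_rel R)"
  proof (rule transI)
    fix p q w assume pq: "(p, q) \<in> proj_rel R" and qw: "(q, w) \<in> proj_rel R"
    obtain a b c a' b' c' r where 1: "p = (a, b, c)" "q = (a', b', c')"
      "p \<in> nonzero_triples R" "q \<in> nonzero_triples R" "r \<in> carrier R" "r \<noteq> \<zero>"
      "a' = r \<otimes> a" "b' = r \<otimes> b" "c' = r \<otimes> c"
      using pq unfolding proj_rel_def by blast
    obtain a'' b'' c'' r' where 2: "w = (a'', b'', c'')"
      "w \<in> nonzero_triples R" "r' \<in> carrier R" "r' \<noteq> \<zero>"
      "a'' = r' \<otimes> a'" "b'' = r' \<otimes> b'" "c'' = r' \<otimes> c'"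
      using qw 1 unfolding proj_rel_def by blast
    have abc: "a \<in> carrier R" "b \<in> carrier R" "c \<in> carrier R"
      using 1 by (auto simp: nonzero_triples_def)
    have "r' \<otimes> r \<noteq> \<zero>" using 1 2 integral by blast
    moreover have "a'' = (r' \<otimes> r) \<otimes> a" "b'' = (r' \<otimes> r) \<otimes> b" "c'' = (r' \<otimes> r) \<otimes> c"
      using 1(5,7-9) 2(3,5-7) abc by (simp_all add: m_assoc)
    moreover have "r' \<otimes> r \<in> carrier R" using 1(5) 2(3) by simp
    ultimately show "(p, w) \<in> proj_rel R"
      using 1(1,3) 2(1,2) unfolding proj_rel_def by blast
  qed
  show "proj_rel R \<subseteq> nonzero_triples R \<times> nonzero_triples R"
    by (auto simp: proj_rel_def)
qed

lemma (in field) hline_direction_unique: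
  assumes "(x, y, t) \<in> carrier (heis R)" "(a, b) \<in> nonzero_pairs R"
    and "(x', y', t') \<in> carrier (heis R)" "(a', b') \<in> nonzero_pairs R"
    and eq: "hline R (x, y, t) a b = hline R (x', y', t') a' b'"
  shows "proj_point R a b (x \<otimes> b \<ominus> y \<otimes> a)
       = proj_point R a' b' (x' \<otimes> b' \<ominus> y' \<otimes> a')"
proof -
  have car: "x \<in> carrier R" "y \<in> carrier R" "t \<in> carrier R"
    "x' \<in> carrier R" "y' \<in> carrier R" "t' \<in> carrier R"
    "a \<in> carrier R" "b \<in> carrier R" "a' \<in> carrier R" "b' \<in> carrier R"
    using assms by (auto simp: heis_def nonzero_pairs_def)
  define c where "c = x \<otimes> b \<ominus> y \<otimes> a"
  define c' where "c' = x' \<otimes> b' \<ominus> y' \<otimes> a'"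
  have cc: "c \<in> carrier R" "c' \<in> carrier R" using car by (auto simp: c_def c'_def)
  note e = eq[unfolded hline_eq[OF assms(1) car(7,8)] hline_eq[OF assms(3) car(9,10)],
      folded c_def c'_def]
  have "(x \<oplus> \<zero> \<otimes> a, y \<oplus> \<zero> \<otimes> b, t \<oplus> \<zero> \<otimes> c)
      \<in> {(x' \<oplus> s \<otimes> a', y' \<oplus> s \<otimes> b', t' \<oplus> s \<otimes> c') | s. s \<in> carrier R}"
    unfolding e[symmetric] by blast
  then obtain s where s: "s \<in> carrier R" "x = x' \<oplus> s \<otimes> a'" "y = y' \<oplus> s \<otimes> b'"
    "t = t' \<oplus> s \<otimes> c'" using car cc by auto
  have "(x \<oplus> \<one> \<otimes> a, y \<oplus> \<one> \<otimes> b, t \<oplus> \<one> \<otimes> c)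
      \<in> {(x' \<oplus> s \<otimes> a', y' \<oplus> s \<otimes> b', t' \<oplus> s \<otimes> c') | s. s \<in> carrier R}"
    unfolding e[symmetric] by blast
  then obtain r where r: "r \<in> carrier R" "x \<oplus> a = x' \<oplus> r \<otimes> a'" "y \<oplus> b = y' \<oplus> r \<otimes> b'"
    "t \<oplus> c = t' \<oplus> r \<otimes> c'" using car cc by auto
  have diff: "z = (r \<ominus> s) \<otimes> w"
    if "u = u' \<oplus> s \<otimes> w" "u \<oplus> z = u' \<oplus> r \<otimes> w" "u' \<in> carrier R" "z \<in> carrier R" "w \<in> carrier R"
    for u u' z w
  proof -
    have "u \<in> carrier R" using that s by simp
    then have "z = (u \<oplus> z) \<ominus> u" using that(4) by algebra
    also have "\<dots> = (u' \<oplus> r \<otimes> w) \<ominus> (u' \<oplus> s \<otimes> w)" by (simp only: that(1)[symmetric] that(2))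
    also have "\<dots> = (r \<ominus> s) \<otimes> w" using that r(1) s(1) by algebra
    finally show ?thesis .
  qed
  have abc: "a = (r \<ominus> s) \<otimes> a'" "b = (r \<ominus> s) \<otimes> b'" "c = (r \<ominus> s) \<otimes> c'"
    using diff[OF s(2) r(2)] diff[OF s(3) r(3)] diff[OF s(4) r(4)] car cc by simp_all
  have "r \<ominus> s \<noteq> \<zero>"
    using abc assms(2) car by (auto simp: nonzero_pairs_def)
  then have "((a', b', c'), (a, b, c)) \<in> proj_rel R"
    using assms(2,4) abc car cc s(1) r(1) unfolding proj_rel_def nonzero_triples_def nonzero_pairs_def
    by (auto intro!: bexI[of _ "r \<ominus> s"])
  then have "proj_point R a b c = proj_point R a' b' c'"
    unfolding proj_point_def using equiv_class_eq[OF equiv_proj_rel] by metis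
  then show ?thesis by (simp add: c_def c'_def)
qed

lemma (in field) Dir_hline:
  assumes "(x, y, t) \<in> carrier (heis R)" "(a, b) \<in> nonzero_pairs R"
  shows "Dir R (hline R (x, y, t) a b) = proj_point R a b (x \<otimes> b \<ominus> y \<otimes> a)"
proof -
  have "\<omega> = proj_point R a b (x \<otimes> b \<ominus> y \<otimes> a)"
    if "\<exists>x\<^sub>0 y\<^sub>0 t\<^sub>0 a' b'.
     (x\<^sub>0, y\<^sub>0, t\<^sub>0) \<in> carrier (heis R) \<and> (a', b') \<in> nonzero_pairs R \<and>
     hline R (x, y, t) a b = hline R (x\<^sub>0, y\<^sub>0, t\<^sub>0) a' b' \<and>
     \<omega> = proj_point R a' b' (x\<^sub>0 \<otimes> b' \<ominus> y\<^sub>0 \<otimes> a')" for \<omega>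
    using that hline_direction_unique[OF assms] by metis
  with assms show ?thesis unfolding Dir_def by (intro the_equality) blast+
qed


section \<open>The refined-direction maximal operator and its sharp exponent\<close>

definition maximal_rd ::
  "('a, 'b) ring_scheme \<Rightarrow> ('a \<times> 'a \<times> 'a \<Rightarrow> complex) \<Rightarrow> ('a \<times> 'a \<times> 'a) set \<Rightarrow> real" where
  "maximal_rd R F \<omega> =
     Max {(\<Sum>p\<in>L. cmod (F p)) | L. L \<in> horizontal_lines R \<and> Dir R L = \<omega>}"

text \<open>
  The norm of \<open>\<ell>\<^sup>p(S)\<close>, with counting measure on a finite non-empty set \<open>S\<close>, for \<open>1 \<le> p \<le> \<infinity>\<close>.
\<close>

definition lp_norm :: "ennreal \<Rightarrow> 'i set \<Rightarrow> ('i \<Rightarrow> complex) \<Rightarrow> real" where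
  "lp_norm p S f =
     (if p = \<infinity> then Max ((\<lambda>x. cmod (f x)) ` S)
      else (\<Sum>x\<in>S. cmod (f x) powr enn2real p) powr (1 / enn2real p))"

text \<open>
  The constant \<open>C\<close> has to be uniform over all finite fields of odd order, so the field is
  quantified inside the formula. Taking carriers in \<open>nat\<close> loses nothing: every finite field is
  isomorphic to such a field (\<open>finite_field_nat_copy\<close>).
\<close>

definition rd_bound :: "ennreal \<Rightarrow> ennreal \<Rightarrow> real \<Rightarrow> bool" where
  "rd_bound u v A \<longleftrightarrow>
     (\<exists>C>0. \<forall>q::nat. primepow q \<and> odd q \<longrightarrow>
        (\<forall>R::nat ring. field R \<and> finite (carrier R) \<and> card (carrier R) = q \<longrightarrow>
           (\<forall>F :: nat \<times> nat \<times> nat \<Rightarrow> complex.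
              lp_norm v (refined_directions R) (\<lambda>\<omega>. complex_of_real (maximal_rd R F \<omega>))
                \<le> C * real q powr A * lp_norm u (carrier (heis R)) F)))"

lemma finite_field_nat_copy:
  assumes "field R" "finite (carrier R)"
  shows "\<exists>S :: nat ring. field S \<and> R \<simeq> S"
proof -
  obtain f :: "'a \<Rightarrow> nat" where f: "inj_on f (carrier R)"
    using finite_imp_inj_to_nat_seg[OF assms(2)] by blast
  interpret field R by fact
  have "field (image_ring f R)" using f by (rule inj_imp_image_ring_is_field)
  moreover have "R \<simeq> image_ring f R"
    unfolding is_ring_iso_def using inj_imp_image_ring_iso[OF f] by blast
  ultimately show ?thesis by blast
qed

text \<open>
  \<open>LEAST\<close> is meaningful only if a smallest admissible exponent exists, which has to be proved
  along with the value of \<open>A_rd\<close>.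
\<close>

definition A_rd :: "ennreal \<Rightarrow> ennreal \<Rightarrow> real" where
  "A_rd u v = (LEAST A. 0 \<le> A \<and> rd_bound u v A)"

end

theory Submission
  imports Defs "HOL-Analysis.Convex" "HOL-Number_Theory.Residues"
begin

text \<open>
  Choosing a line \<open>L \<omega>\<close> for every direction turns the upper bound into a bound for the positive
  bilinear form \<open>\<Sum>\<omega>. \<Sum>p\<in>L \<omega>. f p * g \<omega>\<close>. Hoelder's inequality interpolates such bounds;
  together with the monotonicity of the norms and the passage to smaller \<open>v\<close>, which costs a power
  of \<open>card \<D> \<le> 2 q\<^sup>2\<close>, the exponent follows from the trivial bounds for
  \<open>(1/u, 1/v) = (0,0), (1,0), (1,1)\<close> and the bound \<open>q powr (1/2)\<close>, up to a constant, at
  \<open>(1/2,1/2)\<close>.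

  For the latter, split \<open>f\<close> into its average along the vertical fibres and the rest. The average is
  a function on the plane, where every line of the plane is counted once. On functions of mean zero
  along the fibres, the collinearity operator \<open>B\<close> (including the diagonal) satisfies
  \<open>norm (B f) = q * norm f\<close>, by nondegeneracy of the symplectic form, so that even the sum over all
  horizontal lines of the squared line sums is at most \<open>2 q\<close> times the squared norm of \<open>f\<close>.

  The indicators of a point, of a horizontal line (in two ways) and of the whole group show that
  the exponent is optimal.
\<close>

section \<open>Energy of horizontal lines\<close>

text \<open>A refined direction \<open>[a : b : c]\<close> is the same datum as the plane line of
  all (x, y) with x b - y a = c, and the horizontal lines with this direction are the q vertical
  translates of one lift of it. The maximal operator thus chooses one lift over each plane line.
  Functions constant along the fibres are the obstacle: constants show that the form of
  \<open>B\<close> can reach q^2 times the squared norm, so summing over all horizontal lines loses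
  a factor q. For them all q lifts have the same line sum while only one is counted, and this gives
  the factor back. The mean-zero part has no such symmetry, but there cancellation makes the crude
  sum over all lines good enough. One non-trivial estimate suffices because the four affine
  functions in the exponent coincide at (1/2, 1/2). With \<alpha> = 1/u and \<beta> = 1/v, the
  exponent is max \<beta> (1 - \<alpha>) for \<beta> \<le> \<alpha>; for \<beta> \<ge> \<alpha> it
  is the diagonal value max \<alpha> (1 - \<alpha>) plus 2 (\<beta> - \<alpha>), the price of
  lowering v.\<close>

locale finite_field = field +
  assumes finite_carrier [simp, intro]: "finite (carrier R)"
begin

abbreviation q :: nat where "q \<equiv> card (carrier R)"

abbreviation H :: "('a \<times> 'a \<times> 'a) set" where
  "H \<equiv> carrier R \<times> carrier R \<times> carrier R"

lemma carrier_heis: "carrier (heis R) = H"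
  by (simp add: heis_def)

lemma q_ge_2: "q \<ge> 2"
proof -
  have "card {\<zero>, \<one>} \<le> q" by (intro card_mono) auto
  then show ?thesis by simp
qed

lemma q_pos: "q > 0" using q_ge_2 by simp

section \<open>Right translation by \<open>(a, b, 0)\<close> and bijections of the field and of the
  steps\<close>

definition hstep :: "'a \<Rightarrow> 'a \<Rightarrow> 'a \<times> 'a \<times> 'a \<Rightarrow> 'a \<times> 'a \<times> 'a" where
  "hstep a b = (\<lambda>(x, y, t). (x \<oplus> a, y \<oplus> b, t \<oplus> (x \<otimes> b \<ominus> y \<otimes> a)))"

lemma hstep_closed: "p \<in> H \<Longrightarrow> a \<in> carrier R \<Longrightarrow> b \<in> carrier R \<Longrightarrow> hstep a b p \<in> H"
  by (auto simp: hstep_def)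

text \<open>Parallel steps compose without a vertical defect because the symplectic form vanishes on
  proportional vectors; two general steps would produce the extra term a b' - b a'.\<close>

lemma hstep_hstep:
  assumes "p \<in> H" "a \<in> carrier R" "b \<in> carrier R" "r \<in> carrier R" "s \<in> carrier R"
  shows "hstep (r \<otimes> a) (r \<otimes> b) (hstep (s \<otimes> a) (s \<otimes> b) p) = hstep ((s \<oplus> r) \<otimes> a) ((s \<oplus> r) \<otimes> b) p"
proof -
  obtain x y t where p: "p = (x, y, t)" by (cases p)
  with assms have "x \<in> carrier R" "y \<in> carrier R" "t \<in> carrier R" by auto
  with assms(2-) show ?thesis unfolding p hstep_def prod.case prod.inject
    by (intro conjI; algebra)
qed

lemma hstep_0: "p \<in> H \<Longrightarrow> hstep \<zero> \<zero> p = p"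
  by (auto simp: hstep_def minus_eq)

lemma hstep_minus:
  assumes "p \<in> H" "a \<in> carrier R" "b \<in> carrier R"
  shows "hstep (\<ominus> a) (\<ominus> b) (hstep a b p) = p"
proof -
  have "\<ominus> a = \<ominus> \<one> \<otimes> a" "\<ominus> b = \<ominus> \<one> \<otimes> b" "a = \<one> \<otimes> a" "b = \<one> \<otimes> b"
    using assms by (simp_all add: l_minus)
  then have "hstep (\<ominus> a) (\<ominus> b) (hstep a b p)
      = hstep (\<ominus> \<one> \<otimes> a) (\<ominus> \<one> \<otimes> b) (hstep (\<one> \<otimes> a) (\<one> \<otimes> b) p)"
    by simp
  also have "\<dots> = hstep ((\<one> \<oplus> \<ominus> \<one>) \<otimes> a) ((\<one> \<oplus> \<ominus> \<one>) \<otimes> b) p"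
    using assms by (intro hstep_hstep) auto
  also have "\<dots> = hstep \<zero> \<zero> p"
    using assms(2,3) by (simp only: r_neg one_closed l_null)
  also have "\<dots> = p" by (rule hstep_0[OF assms(1)])
  finally show ?thesis .
qed

lemma bij_hstep:
  assumes "a \<in> carrier R" "b \<in> carrier R"
  shows "bij_betw (hstep a b) H H"
proof (rule bij_betw_byWitness[where f' = "hstep (\<ominus> a) (\<ominus> b)"])
  show "\<forall>p\<in>H. hstep (\<ominus> a) (\<ominus> b) (hstep a b p) = p"
    using hstep_minus[OF _ assms] by (intro ballI)
  show "\<forall>p\<in>H. hstep a b (hstep (\<ominus> a) (\<ominus> b) p) = p"
  proof
    fix p assume "p \<in> H"
    then show "hstep a b (hstep (\<ominus> a) (\<ominus> b) p) = p"
      using assms hstep_minus[of p "\<ominus> a" "\<ominus> b"] by simp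
  qed
  show "hstep a b ` H \<subseteq> H" using assms by (intro image_subsetI hstep_closed)
  show "hstep (\<ominus> a) (\<ominus> b) ` H \<subseteq> H"
    using assms by (intro image_subsetI hstep_closed a_inv_closed)
qed

lemma bij_add: "c \<in> carrier R \<Longrightarrow> bij_betw (\<lambda>x. c \<oplus> x) (carrier R) (carrier R)"
  by (intro bij_betw_byWitness[where f' = "\<lambda>x. \<ominus> c \<oplus> x"]) (auto simp: r_neg1 r_neg2)

lemma inv_nonzero:
  assumes "r \<in> carrier R" "r \<noteq> \<zero>"
  shows "inv r \<in> carrier R" "inv r \<noteq> \<zero>" "r \<otimes> inv r = \<one>" "inv r \<otimes> r = \<one>"
proof -
  have r: "r \<in> Units R" using assms by (simp add: field_Units)
  then have "inv r \<in> Units R" by (rule Units_inv_Units)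
  then show "inv r \<in> carrier R" "inv r \<noteq> \<zero>"
    unfolding field_Units by blast+
  show "r \<otimes> inv r = \<one>" "inv r \<otimes> r = \<one>" using r by auto
qed

lemma inv_cancel:
  assumes "r \<in> carrier R" "r \<noteq> \<zero>" "x \<in> carrier R"
  shows "inv r \<otimes> (r \<otimes> x) = x" "r \<otimes> (inv r \<otimes> x) = x"
  using assms inv_nonzero[OF assms(1,2)] by (simp_all add: m_assoc[symmetric])

lemma bij_mult:
  assumes "r \<in> carrier R" "r \<noteq> \<zero>"
  shows "bij_betw (\<lambda>x. r \<otimes> x) (carrier R) (carrier R)"
  using assms inv_nonzero[OF assms]
  by (intro bij_betw_byWitness[where f' = "\<lambda>x. inv r \<otimes> x"]) (auto simp: inv_cancel)

abbreviation NZ :: "('a \<times> 'a) set" where "NZ \<equiv> nonzero_pairs R"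

lemma NZ_iff: "(a, b) \<in> NZ \<longleftrightarrow> a \<in> carrier R \<and> b \<in> carrier R \<and> (a \<noteq> \<zero> \<or> b \<noteq> \<zero>)"
  by (auto simp: nonzero_pairs_def)

lemma finite_NZ [simp]: "finite NZ" by (simp add: nonzero_pairs_def)

lemma card_NZ: "real (card NZ) = real q ^ 2 - 1"
proof -
  have "card NZ = card (carrier R \<times> carrier R) - card {(\<zero>, \<zero>)}"
    unfolding nonzero_pairs_def by (intro card_Diff_subset) auto
  moreover have "1 \<le> q * q" using q_pos by (simp add: Suc_leI)
  ultimately show ?thesis by (simp add: card_cartesian_product power2_eq_square of_nat_diff)
qed

lemma bij_NZ:
  assumes "r \<in> carrier R" "r \<noteq> \<zero>"
  shows "bij_betw (\<lambda>(a, b). (r \<otimes> a, r \<otimes> b)) NZ NZ"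
proof -
  have into: "(\<lambda>(a, b). (s \<otimes> a, s \<otimes> b)) ` NZ \<subseteq> NZ" if s: "s \<in> carrier R" "s \<noteq> \<zero>" for s
  proof clarify
    fix a b assume "(a, b) \<in> NZ"
    then show "(s \<otimes> a, s \<otimes> b) \<in> NZ" using s integral unfolding NZ_iff by blast
  qed
  note i = inv_nonzero[OF assms]
  show ?thesis
  proof (rule bij_betw_byWitness[where f' = "\<lambda>(a, b). (inv r \<otimes> a, inv r \<otimes> b)"])
    show "\<forall>w\<in>NZ. (case (case w of (a, b) \<Rightarrow> (r \<otimes> a, r \<otimes> b)) of (a, b) \<Rightarrow> (inv r \<otimes> a, inv r \<otimes> b)) = w"
      "\<forall>w\<in>NZ. (case (case w of (a, b) \<Rightarrow> (inv r \<otimes> a, inv r \<otimes> b)) of (a, b) \<Rightarrow> (r \<otimes> a, r \<otimes> b)) = w"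
      using inv_cancel[OF assms] by (auto simp: NZ_iff)
  qed (use into assms i in blast)+
qed

section \<open>Line sums and their second moment\<close>

definition line_sum :: "('a \<times> 'a \<times> 'a \<Rightarrow> real) \<Rightarrow> 'a \<times> 'a \<times> 'a \<Rightarrow> 'a \<Rightarrow> 'a \<Rightarrow> real" where
  "line_sum f p a b = (\<Sum>s\<in>carrier R. f (hstep (s \<otimes> a) (s \<otimes> b) p))"

lemma heis_mult_hstep:
  assumes "p \<in> H" "a \<in> carrier R" "b \<in> carrier R"
  shows "p \<otimes>\<^bsub>heis R\<^esub> (a, b, \<zero>) = hstep a b p"
  using assms by (auto simp: heis_def hstep_def)

lemma hline_hstep:
  assumes "p \<in> H" "a \<in> carrier R" "b \<in> carrier R"
  shows "hline R p a b = (\<lambda>s. hstep (s \<otimes> a) (s \<otimes> b) p) ` carrier R"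
  unfolding hline_def using assms by (intro image_cong refl heis_mult_hstep) auto

lemma r_mult_right_cancel:
  assumes "s \<otimes> a = s' \<otimes> a" "a \<noteq> \<zero>" "s \<in> carrier R" "s' \<in> carrier R" "a \<in> carrier R"
  shows "s = s'"
  using assms m_rcancel by blast

lemma inj_hstep_line:
  assumes "p \<in> H" "(a, b) \<in> NZ"
  shows "inj_on (\<lambda>s. hstep (s \<otimes> a) (s \<otimes> b) p) (carrier R)"
proof (rule inj_onI)
  fix s s' assume s: "s \<in> carrier R" "s' \<in> carrier R"
    and e: "hstep (s \<otimes> a) (s \<otimes> b) p = hstep (s' \<otimes> a) (s' \<otimes> b) p"
  obtain x y t where p: "p = (x, y, t)" by (cases p)
  have "s \<otimes> a = s' \<otimes> a" "s \<otimes> b = s' \<otimes> b"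
    using e s assms by (auto simp: p hstep_def NZ_iff)
  then show "s = s'" using s assms(2) unfolding NZ_iff by (metis r_mult_right_cancel)
qed

lemma sum_hline:
  assumes "p \<in> H" "(a, b) \<in> NZ"
  shows "(\<Sum>z\<in>hline R p a b. f z) = line_sum f p a b"
proof -
  have ab: "a \<in> carrier R" "b \<in> carrier R" using assms(2) by (auto simp: NZ_iff)
  show ?thesis unfolding hline_hstep[OF assms(1) ab] line_sum_def
    by (subst sum.reindex[OF inj_hstep_line[OF assms]]) simp
qed

text \<open>Ranging over parametrisations instead of lines turns translations and rescalings into
  plain reindexings; the price is a multiplicity q (q - 1) for every line.\<close>

definition line_energy :: "('a \<times> 'a \<times> 'a \<Rightarrow> real) \<Rightarrow> real" where
  "line_energy f = (\<Sum>(p, a, b)\<in>H \<times> NZ. (line_sum f p a b)\<^sup>2)"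

text \<open>
  The adjacency operator of the collinearity graph, plus the identity (from \<open>a = b = \<zero>\<close>).
\<close>

definition nbr_sum :: "('a \<times> 'a \<times> 'a \<Rightarrow> real) \<Rightarrow> 'a \<times> 'a \<times> 'a \<Rightarrow> real" where
  "nbr_sum f p = (\<Sum>(a, b)\<in>carrier R \<times> carrier R. f (hstep a b p))"

text \<open>Translation along the step permutes \<open>H\<close>, so a correlation along a line
  depends only on the difference of the two parameters.\<close>

lemma sum_two_shifts:
  assumes "a \<in> carrier R" "b \<in> carrier R" "s \<in> carrier R" "s' \<in> carrier R"
  shows "(\<Sum>p\<in>H. f (hstep (s \<otimes> a) (s \<otimes> b) p) * g (hstep ((s \<oplus> s') \<otimes> a) ((s \<oplus> s') \<otimes> b) p))
    = (\<Sum>p\<in>H. f p * g (hstep (s' \<otimes> a) (s' \<otimes> b) p) :: real)"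
proof -
  have "(\<Sum>p\<in>H. f p * g (hstep (s' \<otimes> a) (s' \<otimes> b) p))
    = (\<Sum>p\<in>H. f (hstep (s \<otimes> a) (s \<otimes> b) p) * g (hstep (s' \<otimes> a) (s' \<otimes> b) (hstep (s \<otimes> a) (s \<otimes> b) p)))"
    using assms by (intro sum.reindex_bij_betw[symmetric] bij_hstep) auto
  also have "\<dots> = (\<Sum>p\<in>H. f (hstep (s \<otimes> a) (s \<otimes> b) p) * g (hstep ((s \<oplus> s') \<otimes> a) ((s \<oplus> s') \<otimes> b) p))"
    using assms by (intro sum.cong refl) (simp only: hstep_hstep)
  finally show ?thesis ..
qed

lemma sum_line_sum_sq:
  assumes "a \<in> carrier R" "b \<in> carrier R"
  shows "(\<Sum>p\<in>H. (line_sum f p a b)\<^sup>2)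
    = real q * (\<Sum>r\<in>carrier R. \<Sum>p\<in>H. f p * f (hstep (r \<otimes> a) (r \<otimes> b) p))"
proof -
  let ?T = "\<lambda>s. hstep (s \<otimes> a) (s \<otimes> b)"
  have "(\<Sum>p\<in>H. (line_sum f p a b)\<^sup>2)
      = (\<Sum>p\<in>H. \<Sum>s\<in>carrier R. \<Sum>r\<in>carrier R. f (?T s p) * f (?T r p))"
    by (simp add: line_sum_def power2_eq_square sum_product)
  also have "\<dots> = (\<Sum>p\<in>H. \<Sum>s\<in>carrier R. \<Sum>r\<in>carrier R. f (?T s p) * f (?T (s \<oplus> r) p))"
    by (intro sum.cong refl sum.reindex_bij_betw[symmetric] bij_add)
  also have "\<dots> = (\<Sum>s\<in>carrier R. \<Sum>p\<in>H. \<Sum>r\<in>carrier R. f (?T s p) * f (?T (s \<oplus> r) p))"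
    by (rule sum.swap)
  also have "\<dots> = (\<Sum>s\<in>carrier R. \<Sum>r\<in>carrier R. \<Sum>p\<in>H. f (?T s p) * f (?T (s \<oplus> r) p))"
    by (intro sum.cong refl sum.swap)
  also have "\<dots> = (\<Sum>s\<in>carrier R. \<Sum>r\<in>carrier R. \<Sum>p\<in>H. f p * f (?T r p))"
    using assms by (intro sum.cong refl sum_two_shifts)
  finally show ?thesis by simp
qed

text \<open>Squaring a line sum pairs points of the line whose parameters differ by some
  \<open>r\<close>. Over all lines, \<open>r = \<zero>\<close> yields the squared norm and every
  other \<open>r\<close> the same sum over all non-zero steps, which is the form of
  \<open>nbr_sum\<close> without its diagonal. The prefactor is the multiplicity of a line.\<close>

lemma line_energy_eq:
  "line_energy f = real q * (real q - 1) *
     (real q * (\<Sum>p\<in>H. (f p)\<^sup>2) + (\<Sum>p\<in>H. f p * nbr_sum f p))"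
proof -
  let ?S = "\<Sum>p\<in>H. (f p)\<^sup>2" and ?K = "carrier R"
  let ?G = "\<lambda>(a, b). \<Sum>p\<in>H. f p * f (hstep a b p)"
  have zero: "?G (\<zero>, \<zero>) = ?S"
    by (auto simp: power2_eq_square hstep_0 intro!: sum.cong)
  \<comment> \<open>\<open>nbr_sum\<close> includes the zero step, whose contribution
    \<open>?S\<close> is taken out here.\<close>
  have "(\<Sum>w\<in>NZ. ?G w) = (\<Sum>w\<in>?K \<times> ?K. ?G w) - ?S"
    unfolding nonzero_pairs_def by (subst sum_diff) (auto simp: zero[simplified])
  also have "(\<Sum>w\<in>?K \<times> ?K. ?G w) = (\<Sum>p\<in>H. f p * nbr_sum f p)"
    unfolding nbr_sum_def case_prod_unfold by (subst sum.swap) (simp add: sum_distrib_left)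
  finally have G: "(\<Sum>w\<in>NZ. ?G w) = (\<Sum>p\<in>H. f p * nbr_sum f p) - ?S" .
  have "line_energy f = (\<Sum>(a, b)\<in>NZ. \<Sum>p\<in>H. (line_sum f p a b)\<^sup>2)"
    unfolding line_energy_def case_prod_unfold
    by (subst sum.cartesian_product') (simp only: fst_conv snd_conv, rule sum.swap)
  also have "\<dots> = (\<Sum>(a, b)\<in>NZ. real q * (\<Sum>r\<in>?K. \<Sum>p\<in>H. f p * f (hstep (r \<otimes> a) (r \<otimes> b) p)))"
    by (intro sum.cong refl) (auto simp: NZ_iff sum_line_sum_sq)
  also have "\<dots> = real q * (\<Sum>r\<in>?K. \<Sum>(a, b)\<in>NZ. ?G (r \<otimes> a, r \<otimes> b))"
    unfolding case_prod_unfold by (subst sum.swap) (simp add: sum_distrib_left)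
  \<comment> \<open>At \<open>r = \<zero>\<close> each point is paired with itself; any other
    \<open>r\<close> merely permutes \<open>NZ\<close>.\<close>
  also have "(\<Sum>r\<in>?K. \<Sum>(a, b)\<in>NZ. ?G (r \<otimes> a, r \<otimes> b))
      = (\<Sum>(a, b)\<in>NZ. ?G (\<zero> \<otimes> a, \<zero> \<otimes> b)) + (\<Sum>r\<in>?K - {\<zero>}. \<Sum>(a, b)\<in>NZ. ?G (r \<otimes> a, r \<otimes> b))"
    by (intro sum.remove) auto
  also have "(\<Sum>(a, b)\<in>NZ. ?G (\<zero> \<otimes> a, \<zero> \<otimes> b)) = (\<Sum>(a, b)\<in>NZ. ?S)"
    using zero by (intro sum.cong refl) (auto simp: NZ_iff)
  also have "\<dots> = (real q ^ 2 - 1) * ?S"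
    using card_NZ by (simp add: case_prod_unfold)
  also have "(\<Sum>r\<in>?K - {\<zero>}. \<Sum>(a, b)\<in>NZ. ?G (r \<otimes> a, r \<otimes> b)) = (\<Sum>r\<in>?K - {\<zero>}. \<Sum>w\<in>NZ. ?G w)"
  proof (rule sum.cong[OF refl])
    fix r assume "r \<in> ?K - {\<zero>}"
    then have r: "bij_betw (\<lambda>(a, b). (r \<otimes> a, r \<otimes> b)) NZ NZ" using bij_NZ by blast
    show "(\<Sum>(a, b)\<in>NZ. ?G (r \<otimes> a, r \<otimes> b)) = (\<Sum>w\<in>NZ. ?G w)"
      using sum.reindex_bij_betw[OF r, of ?G] by (simp add: case_prod_unfold)
  qed
  also have "\<dots> = (real q - 1) * (\<Sum>w\<in>NZ. ?G w)"
    using q_pos by (simp add: card_Diff_singleton of_nat_diff Suc_leI)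
  finally show ?thesis unfolding G by (simp add: algebra_simps power2_eq_square)
qed

lemma sum_hstep_sq:
  assumes "a \<in> carrier R" "b \<in> carrier R"
  shows "(\<Sum>p\<in>H. (f (hstep a b p))\<^sup>2) = (\<Sum>p\<in>H. (f p :: real)\<^sup>2)"
  using sum.reindex_bij_betw[OF bij_hstep[OF assms], of "\<lambda>p. (f p)\<^sup>2"] .

text \<open>Each of the q^2 steps is a permutation of \<open>H\<close>, so its correlation is at
  most the squared norm. Constants attain equality, hence this is too weak for general
  \<open>f\<close> and serves the fibre averages.\<close>

lemma nbr_form_le: "(\<Sum>p\<in>H. f p * nbr_sum f p) \<le> real q ^ 2 * (\<Sum>p\<in>H. (f p)\<^sup>2)"
proof -
  let ?K = "carrier R"
  have *: "(\<Sum>p\<in>H. f p * f (hstep a b p)) \<le> (\<Sum>p\<in>H. (f p)\<^sup>2)" if "a \<in> ?K" "b \<in> ?K" for a b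
  proof -
    have "(\<Sum>p\<in>H. f p * f (hstep a b p)) \<le> (\<Sum>p\<in>H. ((f p)\<^sup>2 + (f (hstep a b p))\<^sup>2) / 2)"
    proof (rule sum_mono)
      fix p show "f p * f (hstep a b p) \<le> ((f p)\<^sup>2 + (f (hstep a b p))\<^sup>2) / 2"
        using sum_squares_bound[of "f p" "f (hstep a b p)"] by simp
    qed
    also have "\<dots> = (\<Sum>p\<in>H. (f p)\<^sup>2)"
      using sum_hstep_sq[OF that, of f] by (simp add: sum_divide_distrib[symmetric] sum.distrib)
    finally show ?thesis .
  qed
  have "(\<Sum>p\<in>H. f p * nbr_sum f p) = (\<Sum>(a, b)\<in>?K \<times> ?K. \<Sum>p\<in>H. f p * f (hstep a b p))"
    unfolding nbr_sum_def case_prod_unfold by (subst sum.swap) (simp add: sum_distrib_left)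
  also have "\<dots> \<le> (\<Sum>(a, b)\<in>?K \<times> ?K. \<Sum>p\<in>H. (f p)\<^sup>2)"
    by (intro sum_mono) (auto intro: *)
  finally show ?thesis by (simp add: card_cartesian_product power2_eq_square case_prod_unfold)
qed

section \<open>Cancellation along the vertical fibres\<close>

lemma sum_shift:
  assumes "c \<in> carrier R"
  shows "(\<Sum>x\<in>carrier R. h (x \<oplus> c)) = (\<Sum>x\<in>carrier R. h x)"
proof -
  have "(\<Sum>x\<in>carrier R. h (x \<oplus> c)) = (\<Sum>x\<in>carrier R. h (c \<oplus> x))"
    using assms by (intro sum.cong) (auto simp: a_comm)
  then show ?thesis using sum.reindex_bij_betw[OF bij_add[OF assms], of h] by simp
qed

lemma sum_affine:
  assumes "c \<in> carrier R" "d \<in> carrier R" "d \<noteq> \<zero>"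
  shows "(\<Sum>x\<in>carrier R. h (c \<oplus> d \<otimes> x)) = (\<Sum>x\<in>carrier R. h x)"
  using sum.reindex_bij_betw[OF bij_mult[OF assms(2,3)], of "\<lambda>x. h (c \<oplus> x)"]
    sum.reindex_bij_betw[OF bij_add[OF assms(1)], of h] by simp

lemma diff_eq_zero:
  assumes "x \<in> carrier R" "y \<in> carrier R"
  shows "x \<ominus> y = \<zero> \<longleftrightarrow> x = y"
proof
  assume "x \<ominus> y = \<zero>"
  moreover have "x = (x \<ominus> y) \<oplus> y" using assms by algebra
  ultimately show "x = y" using assms by simp
qed (use assms in \<open>simp add: minus_eq r_neg\<close>)

text \<open>The map (x, y) to x d - y c is a non-zero linear functional, so it takes every value
  exactly q times. The case split selects a variable with invertible coefficient.\<close>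

lemma sum_symplectic:
  fixes h :: "'a \<Rightarrow> real"
  assumes "(c, d) \<in> NZ"
  shows "(\<Sum>x\<in>carrier R. \<Sum>y\<in>carrier R. h (x \<otimes> d \<ominus> y \<otimes> c)) = real q * (\<Sum>x\<in>carrier R. h x)"
proof -
  have cd: "c \<in> carrier R" "d \<in> carrier R" using assms by (auto simp: NZ_iff)
  show ?thesis
  proof (cases "d = \<zero>")
    case True
    then have c: "\<ominus> c \<noteq> \<zero>" using assms by (metis NZ_iff minus_zero minus_minus)
    have "(\<Sum>y\<in>carrier R. h (x \<otimes> d \<ominus> y \<otimes> c)) = (\<Sum>y\<in>carrier R. h y)" if x: "x \<in> carrier R" for x
    proof -
      have "x \<otimes> d \<ominus> y \<otimes> c = x \<otimes> d \<oplus> (\<ominus> c) \<otimes> y" if "y \<in> carrier R" for y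
        using that cd x by algebra
      then show ?thesis using cd x c sum_affine[of "x \<otimes> d" "\<ominus> c" h] by simp
    qed
    then show ?thesis by simp
  next
    case False
    have "(\<Sum>x\<in>carrier R. h (x \<otimes> d \<ominus> y \<otimes> c)) = (\<Sum>y\<in>carrier R. h y)" if y: "y \<in> carrier R" for y
    proof -
      have "x \<otimes> d \<ominus> y \<otimes> c = \<ominus> (y \<otimes> c) \<oplus> d \<otimes> x" if "x \<in> carrier R" for x
        using that cd y by algebra
      then show ?thesis using cd y False sum_affine[of "\<ominus> (y \<otimes> c)" d h] by simp
    qed
    then show ?thesis by (subst sum.swap) simp
  qed
qed

text \<open>Each vertical fibre contains exactly one term of the sum. Parametrising by the plane
  position of the endpoint instead of the step leaves the form unchanged, since it vanishes on equal
  arguments.\<close>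

lemma nbr_sum_eq:
  assumes "x \<in> carrier R" "y \<in> carrier R" "t \<in> carrier R"
  shows "nbr_sum f (x, y, t) =
    (\<Sum>(x', y')\<in>carrier R \<times> carrier R. f (x', y', t \<oplus> (x \<otimes> y' \<ominus> y \<otimes> x')))"
proof -
  let ?K = "carrier R"
  have "(\<Sum>(x', y')\<in>?K \<times> ?K. f (x', y', t \<oplus> (x \<otimes> y' \<ominus> y \<otimes> x')))
    = (\<Sum>a\<in>?K. \<Sum>b\<in>?K. f (x \<oplus> a, y \<oplus> b, t \<oplus> (x \<otimes> (y \<oplus> b) \<ominus> y \<otimes> (x \<oplus> a))))"
    unfolding sum.cartesian_product[symmetric]
    by (subst sum.reindex_bij_betw[OF bij_add[OF assms(1)], symmetric],
        subst sum.reindex_bij_betw[OF bij_add[OF assms(2)], symmetric]) (rule refl)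
  also have "\<dots> = (\<Sum>a\<in>?K. \<Sum>b\<in>?K. f (x \<oplus> a, y \<oplus> b, t \<oplus> (x \<otimes> b \<ominus> y \<otimes> a)))"
  proof (intro sum.cong refl)
    fix a b assume ab: "a \<in> ?K" "b \<in> ?K"
    have "x \<otimes> (y \<oplus> b) \<ominus> y \<otimes> (x \<oplus> a) = x \<otimes> b \<ominus> y \<otimes> a"
      using assms ab by algebra
    then show "f (x \<oplus> a, y \<oplus> b, t \<oplus> (x \<otimes> (y \<oplus> b) \<ominus> y \<otimes> (x \<oplus> a)))
        = f (x \<oplus> a, y \<oplus> b, t \<oplus> (x \<otimes> b \<ominus> y \<otimes> a))"
      by simp
  qed
  finally show ?thesis by (simp add: nbr_sum_def hstep_def sum.cartesian_product)
qed

text \<open>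
  For two distinct fibres the difference of the symplectic forms is equidistributed over the
  field, so only the diagonal terms survive for functions of mean zero along the fibres.
\<close>

lemma nbr_sum_sq:
  assumes mean0: "\<And>x y. x \<in> carrier R \<Longrightarrow> y \<in> carrier R \<Longrightarrow> (\<Sum>t\<in>carrier R. f (x, y, t)) = 0"
  shows "(\<Sum>p\<in>H. (nbr_sum f p)\<^sup>2) = real q ^ 2 * (\<Sum>p\<in>H. (f p)\<^sup>2)"
proof -
  let ?K = "carrier R"
  define g where "g w t = f (fst w, snd w, t)" for w t
  define \<sigma> where "\<sigma> z w = fst z \<otimes> snd w \<ominus> snd z \<otimes> fst w" for z w
  have \<sigma>: "\<sigma> z w \<in> ?K" if "z \<in> ?K \<times> ?K" "w \<in> ?K \<times> ?K" for z w
    using that by (auto simp: \<sigma>_def)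
  have H_sum: "(\<Sum>p\<in>H. h p) = (\<Sum>z\<in>?K \<times> ?K. \<Sum>t\<in>?K. h (fst z, snd z, t))" for h :: "_ \<Rightarrow> real"
    by (simp add: sum.cartesian_product')
  \<comment> \<open>A shift of \<open>t\<close> leaves only the difference of the two forms, so that
    a single factor depends on \<open>z\<close>.\<close>
  have inner: "(\<Sum>t\<in>?K. g w (t \<oplus> \<sigma> z w) * g w' (t \<oplus> \<sigma> z w'))
      = (\<Sum>t\<in>?K. g w t * g w' (t \<oplus> (\<sigma> z w' \<ominus> \<sigma> z w)))"
    if "z \<in> ?K \<times> ?K" "w \<in> ?K \<times> ?K" "w' \<in> ?K \<times> ?K" for z w w'
  proof -
    have s: "\<sigma> z w \<in> ?K" "\<sigma> z w' \<in> ?K" using that \<sigma> by auto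
    have "t \<oplus> \<sigma> z w \<oplus> (\<sigma> z w' \<ominus> \<sigma> z w) = t \<oplus> \<sigma> z w'" if "t \<in> ?K" for t
      using that s by algebra
    then show ?thesis
      using sum_shift[OF s(1), of "\<lambda>t. g w t * g w' (t \<oplus> (\<sigma> z w' \<ominus> \<sigma> z w))"] by simp
  qed
  have off: "(\<Sum>z\<in>?K \<times> ?K. \<Sum>t\<in>?K. g w (t \<oplus> \<sigma> z w) * g w' (t \<oplus> \<sigma> z w'))
      = (if w' = w then real q ^ 2 * (\<Sum>t\<in>?K. (g w t)\<^sup>2) else 0)"
    if w: "w \<in> ?K \<times> ?K" and w': "w' \<in> ?K \<times> ?K" for w w'
  proof (cases "w' = w")
    case True
    have "(\<Sum>t\<in>?K. g w (t \<oplus> \<sigma> z w) * g w (t \<oplus> \<sigma> z w)) = (\<Sum>t\<in>?K. (g w t)\<^sup>2)"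
      if "z \<in> ?K \<times> ?K" for z
      using sum_shift[OF \<sigma>[OF that w], of "\<lambda>t. (g w t)\<^sup>2"] by (simp add: power2_eq_square)
    with True show ?thesis by (simp add: card_cartesian_product power2_eq_square)
  next
    case False
    obtain x' y' u v where e: "w = (x', y')" "w' = (u, v)" by (cases w, cases w')
    then have K: "x' \<in> ?K" "y' \<in> ?K" "u \<in> ?K" "v \<in> ?K" using w w' by auto
    have nz: "(u \<ominus> x', v \<ominus> y') \<in> NZ"
      using False K by (auto simp: NZ_iff e diff_eq_zero)
    \<comment> \<open>By bilinearity the difference is the form of \<open>z\<close> against
      \<open>w' - w\<close>, a non-zero vector in this case.\<close>
    have d: "\<sigma> z w' \<ominus> \<sigma> z w = fst z \<otimes> (v \<ominus> y') \<ominus> snd z \<otimes> (u \<ominus> x')" if "z \<in> ?K \<times> ?K" for z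
    proof -
      have "fst z \<in> ?K" "snd z \<in> ?K" using that by auto
      then show ?thesis unfolding \<sigma>_def e fst_conv snd_conv using K by algebra
    qed
    have "(\<Sum>z\<in>?K \<times> ?K. \<Sum>t\<in>?K. g w (t \<oplus> \<sigma> z w) * g w' (t \<oplus> \<sigma> z w'))
        = (\<Sum>z\<in>?K \<times> ?K. \<Sum>t\<in>?K. g w t * g w' (t \<oplus> (fst z \<otimes> (v \<ominus> y') \<ominus> snd z \<otimes> (u \<ominus> x'))))"
    proof (rule sum.cong[OF refl])
      fix z assume z: "z \<in> ?K \<times> ?K"
      show "(\<Sum>t\<in>?K. g w (t \<oplus> \<sigma> z w) * g w' (t \<oplus> \<sigma> z w'))
          = (\<Sum>t\<in>?K. g w t * g w' (t \<oplus> (fst z \<otimes> (v \<ominus> y') \<ominus> snd z \<otimes> (u \<ominus> x'))))"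
        by (simp only: inner[OF z w w'] d[OF z])
    qed
    also have "\<dots> = (\<Sum>t\<in>?K. g w t * (\<Sum>z\<in>?K \<times> ?K. g w' (t \<oplus> (fst z \<otimes> (v \<ominus> y') \<ominus> snd z \<otimes> (u \<ominus> x')))))"
      by (subst sum.swap) (simp add: sum_distrib_left)
    also have "\<dots> = (\<Sum>t\<in>?K. g w t * (real q * (\<Sum>\<tau>\<in>?K. g w' (t \<oplus> \<tau>))))"
      using sum_symplectic[OF nz, of "\<lambda>\<tau>. g w' (t \<oplus> \<tau>)" for t]
      by (simp add: sum.cartesian_product')
    also have "\<dots> = 0"
    proof (rule sum.neutral, rule ballI)
      fix t assume t: "t \<in> ?K"
      have "(\<Sum>\<tau>\<in>?K. g w' (t \<oplus> \<tau>)) = (\<Sum>\<tau>\<in>?K. g w' \<tau>)"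
        by (rule sum.reindex_bij_betw[OF bij_add[OF t]])
      also have "\<dots> = 0" using mean0 K by (simp add: g_def e)
      finally show "g w t * (real q * (\<Sum>\<tau>\<in>?K. g w' (t \<oplus> \<tau>))) = 0" by simp
    qed
    finally show ?thesis using False by simp
  qed
  have "(\<Sum>p\<in>H. (nbr_sum f p)\<^sup>2)
      = (\<Sum>z\<in>?K \<times> ?K. \<Sum>t\<in>?K. (\<Sum>w\<in>?K \<times> ?K. g w (t \<oplus> \<sigma> z w))\<^sup>2)"
    unfolding H_sum
    by (intro sum.cong refl) (auto simp: nbr_sum_eq g_def \<sigma>_def case_prod_unfold)
  also have "\<dots> = (\<Sum>z\<in>?K \<times> ?K. \<Sum>t\<in>?K. \<Sum>w\<in>?K \<times> ?K. \<Sum>w'\<in>?K \<times> ?K.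
      g w (t \<oplus> \<sigma> z w) * g w' (t \<oplus> \<sigma> z w'))"
    by (simp only: power2_eq_square sum_product)
  \<comment> \<open>The swaps move the sums over \<open>z\<close> and \<open>t\<close> inside,
    because the cancellation for a fixed pair of fibres happens there.\<close>
  also have "\<dots> = (\<Sum>z\<in>?K \<times> ?K. \<Sum>w\<in>?K \<times> ?K. \<Sum>t\<in>?K. \<Sum>w'\<in>?K \<times> ?K.
      g w (t \<oplus> \<sigma> z w) * g w' (t \<oplus> \<sigma> z w'))"
    by (rule sum.cong[OF refl], rule sum.swap)
  also have "\<dots> = (\<Sum>z\<in>?K \<times> ?K. \<Sum>w\<in>?K \<times> ?K. \<Sum>w'\<in>?K \<times> ?K. \<Sum>t\<in>?K.
      g w (t \<oplus> \<sigma> z w) * g w' (t \<oplus> \<sigma> z w'))"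
    by (rule sum.cong[OF refl], rule sum.cong[OF refl], rule sum.swap)
  also have "\<dots> = (\<Sum>w\<in>?K \<times> ?K. \<Sum>z\<in>?K \<times> ?K. \<Sum>w'\<in>?K \<times> ?K. \<Sum>t\<in>?K.
      g w (t \<oplus> \<sigma> z w) * g w' (t \<oplus> \<sigma> z w'))"
    by (rule sum.swap)
  also have "\<dots> = (\<Sum>w\<in>?K \<times> ?K. \<Sum>w'\<in>?K \<times> ?K. \<Sum>z\<in>?K \<times> ?K. \<Sum>t\<in>?K.
      g w (t \<oplus> \<sigma> z w) * g w' (t \<oplus> \<sigma> z w'))"
    by (rule sum.cong[OF refl], rule sum.swap)
  also have "\<dots> = (\<Sum>w\<in>?K \<times> ?K. \<Sum>w'\<in>?K \<times> ?K.
      if w' = w then real q ^ 2 * (\<Sum>t\<in>?K. (g w t)\<^sup>2) else 0)"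
    by (rule sum.cong[OF refl], rule sum.cong[OF refl], rule off)
  also have "\<dots> = (\<Sum>w\<in>?K \<times> ?K. real q ^ 2 * (\<Sum>t\<in>?K. (g w t)\<^sup>2))"
    by (intro sum.cong refl) (subst sum.delta; simp)
  also have "\<dots> = real q ^ 2 * (\<Sum>p\<in>H. (f p)\<^sup>2)"
    unfolding H_sum by (simp only: sum_distrib_left g_def)
  finally show ?thesis .
qed

text \<open>By \<open>nbr_sum_sq\<close> the operator multiplies the norm by q on this space, so
  Cauchy-Schwarz bounds its form by q times the squared norm.\<close>

lemma nbr_form_mean0_le:
  assumes "\<And>x y. x \<in> carrier R \<Longrightarrow> y \<in> carrier R \<Longrightarrow> (\<Sum>t\<in>carrier R. f (x, y, t)) = 0"
  shows "(\<Sum>p\<in>H. f p * nbr_sum f p) \<le> real q * (\<Sum>p\<in>H. (f p)\<^sup>2)"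
proof -
  let ?S = "\<Sum>p\<in>H. (f p)\<^sup>2"
  \<comment> \<open>The weight \<open>real q\<close> balances the two squares in the inequality 2 x
    y \<le> x^2 + y^2: both sums equal q^2 times the squared norm.\<close>
  have "2 * real q * (\<Sum>p\<in>H. f p * nbr_sum f p) = (\<Sum>p\<in>H. 2 * (real q * f p) * nbr_sum f p)"
    by (simp add: sum_distrib_left mult.assoc)
  also have "\<dots> \<le> (\<Sum>p\<in>H. (real q * f p)\<^sup>2 + (nbr_sum f p)\<^sup>2)"
    by (intro sum_mono sum_squares_bound)
  also have "\<dots> = 2 * real q * (real q * ?S)"
  proof -
    have "(\<Sum>p\<in>H. (real q * f p)\<^sup>2) = real q ^ 2 * ?S"
      by (simp add: power_mult_distrib sum_distrib_left)
    moreover have "(\<Sum>p\<in>H. (nbr_sum f p)\<^sup>2) = real q ^ 2 * ?S"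
      by (rule nbr_sum_sq) (rule assms)
    ultimately show ?thesis by (simp only: sum.distrib) (simp add: power2_eq_square[of "real q"])
  qed
  finally show ?thesis using q_pos by simp
qed

section \<open>Lines of a given refined direction, and the quadratic estimate for one line per
  direction\<close>

definition direction :: "'a \<times> 'a \<times> 'a \<Rightarrow> 'a \<Rightarrow> 'a \<Rightarrow> ('a \<times> 'a \<times> 'a) set" where
  "direction p a b = proj_point R a b (fst p \<otimes> b \<ominus> fst (snd p) \<otimes> a)"

lemma proj_point_scale:
  assumes "(a, b) \<in> NZ" "c \<in> carrier R" "r \<in> carrier R" "r \<noteq> \<zero>"
  shows "proj_point R (r \<otimes> a) (r \<otimes> b) (r \<otimes> c) = proj_point R a b c"
proof -
  have ab: "a \<in> carrier R" "b \<in> carrier R" using assms(1) by (auto simp: NZ_iff)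
  have "(r \<otimes> a, r \<otimes> b) \<in> NZ" using bij_betwE[OF bij_NZ[OF assms(3,4)]] assms(1) by auto
  then have "((a, b, c), (r \<otimes> a, r \<otimes> b, r \<otimes> c)) \<in> proj_rel R"
    using assms ab unfolding proj_rel_def nonzero_triples_def NZ_iff by auto
  then show ?thesis unfolding proj_point_def by (rule equiv_class_eq[OF equiv_proj_rel, symmetric])
qed

lemma direction_hstep:
  assumes "p \<in> H" "(a, b) \<in> NZ" "s \<in> carrier R" "r \<in> carrier R" "r \<noteq> \<zero>"
  shows "direction (hstep (s \<otimes> a) (s \<otimes> b) p) (r \<otimes> a) (r \<otimes> b) = direction p a b"
proof -
  obtain x y t where p: "p = (x, y, t)" by (cases p)
  have K: "a \<in> carrier R" "b \<in> carrier R" "x \<in> carrier R" "y \<in> carrier R"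
    using assms by (auto simp: NZ_iff p)
  \<comment> \<open>Moving the base point along the line does not change the form against the step,
    since the form of two parallel vectors vanishes; rescaling the step multiplies it by
    \<open>r\<close>.\<close>
  have "(x \<oplus> s \<otimes> a) \<otimes> (r \<otimes> b) \<ominus> (y \<oplus> s \<otimes> b) \<otimes> (r \<otimes> a) = r \<otimes> (x \<otimes> b \<ominus> y \<otimes> a)"
    using K assms(3,4) by algebra
  then show ?thesis unfolding direction_def p hstep_def
    using proj_point_scale[OF assms(2) _ assms(4,5)] K by simp
qed

lemma line_sum_hstep:
  assumes "p \<in> H" "(a, b) \<in> NZ" "s \<in> carrier R" "r \<in> carrier R" "r \<noteq> \<zero>"
  shows "line_sum f (hstep (s \<otimes> a) (s \<otimes> b) p) (r \<otimes> a) (r \<otimes> b) = line_sum f p a b"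
proof -
  have K: "a \<in> carrier R" "b \<in> carrier R" using assms by (auto simp: NZ_iff)
  have "hstep (u \<otimes> (r \<otimes> a)) (u \<otimes> (r \<otimes> b)) (hstep (s \<otimes> a) (s \<otimes> b) p)
      = hstep ((s \<oplus> r \<otimes> u) \<otimes> a) ((s \<oplus> r \<otimes> u) \<otimes> b) p" if "u \<in> carrier R" for u
  proof -
    have "u \<otimes> (r \<otimes> a) = (r \<otimes> u) \<otimes> a" "u \<otimes> (r \<otimes> b) = (r \<otimes> u) \<otimes> b"
      using K that assms(4) by (simp_all add: m_ac)
    then show ?thesis using hstep_hstep[OF assms(1) K] that assms by simp
  qed
  then show ?thesis unfolding line_sum_def
    using sum_affine[OF assms(3-5), of "\<lambda>u. f (hstep (u \<otimes> a) (u \<otimes> b) p)"] by simp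
qed

text \<open>Translation by the central element (0, 0, \<tau>), which carries a horizontal line to
  the other lifts of the same plane line.\<close>

definition vshift :: "'a \<Rightarrow> 'a \<times> 'a \<times> 'a \<Rightarrow> 'a \<times> 'a \<times> 'a" where
  "vshift \<tau> = (\<lambda>(x, y, t). (x, y, t \<oplus> \<tau>))"

lemma vshift_closed: "p \<in> H \<Longrightarrow> \<tau> \<in> carrier R \<Longrightarrow> vshift \<tau> p \<in> H"
  by (auto simp: vshift_def)

lemma direction_vshift: "direction (vshift \<tau> p) = direction p"
  by (cases p) (simp add: fun_eq_iff direction_def vshift_def)

text \<open>The plane coordinates determine \<open>s\<close>, because the step is non-zero; after
  that the vertical coordinate determines \<tau>.\<close>

lemma inj_line_param:
  assumes p: "p \<in> H" and ab: "(a, b) \<in> NZ"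
    and s: "s \<in> carrier R" "s' \<in> carrier R" and t: "\<tau> \<in> carrier R" "\<tau>' \<in> carrier R"
    and r: "r \<in> carrier R" "r' \<in> carrier R"
    and e: "hstep (s \<otimes> a) (s \<otimes> b) (vshift \<tau> p) = hstep (s' \<otimes> a) (s' \<otimes> b) (vshift \<tau>' p)"
    and er: "r \<otimes> a = r' \<otimes> a" "r \<otimes> b = r' \<otimes> b"
  shows "s = s'" "\<tau> = \<tau>'" "r = r'"
proof -
  obtain x y u where pe: "p = (x, y, u)" by (cases p)
  have K: "a \<in> carrier R" "b \<in> carrier R" "x \<in> carrier R" "y \<in> carrier R" "u \<in> carrier R"
    using p ab by (auto simp: NZ_iff pe)
  have "s \<otimes> a = s' \<otimes> a" "s \<otimes> b = s' \<otimes> b"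
    using e s K by (auto simp: pe hstep_def vshift_def)
  then show ss: "s = s'" using s ab unfolding NZ_iff by (metis r_mult_right_cancel)
  show "r = r'" using r er ab unfolding NZ_iff by (metis r_mult_right_cancel)
  show "\<tau> = \<tau>'" using e s t K unfolding ss by (auto simp: pe hstep_def vshift_def)
qed

text \<open>
  Every line is parametrised by \<open>q (q - 1)\<close> triples \<open>(p, a, b)\<close>; if \<open>f\<close> does not distinguish the
  lifts of a plane line, all \<open>q\<close> lifts count, which is the gain from \<open>T = carrier R\<close>.
\<close>

lemma sum_directions_le_energy:
  assumes fin: "finite D" and T: "T \<subseteq> carrier R"
    and P: "\<And>\<omega>. \<omega> \<in> D \<Longrightarrow> P \<omega> \<in> H" and ab: "\<And>\<omega>. \<omega> \<in> D \<Longrightarrow> (a \<omega>, b \<omega>) \<in> NZ"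
    and direction: "\<And>\<omega>. \<omega> \<in> D \<Longrightarrow> direction (P \<omega>) (a \<omega>) (b \<omega>) = \<omega>"
    and vshift: "\<And>\<omega> \<tau>. \<omega> \<in> D \<Longrightarrow> \<tau> \<in> T \<Longrightarrow>
      line_sum f (vshift \<tau> (P \<omega>)) (a \<omega>) (b \<omega>) = line_sum f (P \<omega>) (a \<omega>) (b \<omega>)"
  shows "real (card T) * (real q * (real q - 1)) * (\<Sum>\<omega>\<in>D. (line_sum f (P \<omega>) (a \<omega>) (b \<omega>))\<^sup>2)
    \<le> line_energy f"
proof -
  let ?K = "carrier R"
  define I where "I = D \<times> ?K \<times> T \<times> (?K - {\<zero>})"
  define \<Phi> where "\<Phi> = (\<lambda>(\<omega>, s, \<tau>, r).
    (hstep (s \<otimes> a \<omega>) (s \<otimes> b \<omega>) (vshift \<tau> (P \<omega>)), r \<otimes> a \<omega>, r \<otimes> b \<omega>))"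
  define G where "G = (\<lambda>(p, a, b). (line_sum f p a b)\<^sup>2)"
  have closed: "\<Phi> ` I \<subseteq> H \<times> NZ"
  proof (rule image_subsetI)
    fix i assume "i \<in> I"
    then obtain \<omega> s \<tau> r where i: "i = (\<omega>, s, \<tau>, r)" "\<omega> \<in> D" "s \<in> ?K" "\<tau> \<in> ?K" "r \<in> ?K" "r \<noteq> \<zero>"
      using T unfolding I_def by blast
    have K: "a \<omega> \<in> ?K" "b \<omega> \<in> ?K" using ab[OF i(2)] by (auto simp: NZ_iff)
    have "hstep (s \<otimes> a \<omega>) (s \<otimes> b \<omega>) (vshift \<tau> (P \<omega>)) \<in> H"
      using i K P by (intro hstep_closed vshift_closed) auto
    moreover have "(r \<otimes> a \<omega>, r \<otimes> b \<omega>) \<in> NZ"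
      using bij_betwE[OF bij_NZ[OF i(5,6)]] ab[OF i(2)] by auto
    ultimately show "\<Phi> i \<in> H \<times> NZ" unfolding i(1) \<Phi>_def prod.case by (rule SigmaI)
  qed
  have inj: "inj_on \<Phi> I"
  proof (rule inj_onI)
    fix i j assume "i \<in> I" "j \<in> I" and e: "\<Phi> i = \<Phi> j"
    then obtain \<omega> s \<tau> r \<omega>' s' \<tau>' r' where
      i: "i = (\<omega>, s, \<tau>, r)" "\<omega> \<in> D" "s \<in> ?K" "\<tau> \<in> ?K" "r \<in> ?K" "r \<noteq> \<zero>" and
      j: "j = (\<omega>', s', \<tau>', r')" "\<omega>' \<in> D" "s' \<in> ?K" "\<tau>' \<in> ?K" "r' \<in> ?K" "r' \<noteq> \<zero>"
      using T unfolding I_def by blast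
    have e': "hstep (s \<otimes> a \<omega>) (s \<otimes> b \<omega>) (vshift \<tau> (P \<omega>)) = hstep (s' \<otimes> a \<omega>') (s' \<otimes> b \<omega>') (vshift \<tau>' (P \<omega>'))"
      "r \<otimes> a \<omega> = r' \<otimes> a \<omega>'" "r \<otimes> b \<omega> = r' \<otimes> b \<omega>'"
      using e by (simp_all add: \<Phi>_def i(1) j(1))
    \<comment> \<open>\<open>direction\<close> is invariant under vertical shifts and under
      reparametrisation, so it recovers \<omega> from its image under \<Phi>.\<close>
    have "\<omega> = \<omega>'"
      using direction_hstep[OF vshift_closed[OF P[OF i(2)] i(4)] ab[OF i(2)] i(3,5,6)]
        direction_hstep[OF vshift_closed[OF P[OF j(2)] j(4)] ab[OF j(2)] j(3,5,6)]
      unfolding e' direction_vshift direction[OF i(2)] direction[OF j(2)] by simp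
    moreover from this have "s = s'" "\<tau> = \<tau>'" "r = r'"
      using inj_line_param[OF P[OF i(2)] ab[OF i(2)] i(3) j(3) i(4) j(4) i(5) j(5)] e' by blast+
    ultimately show "i = j" by (simp add: i(1) j(1))
  qed
  have "(\<Sum>i\<in>I. G (\<Phi> i)) = (\<Sum>z\<in>\<Phi> ` I. G z)"
    using sum.reindex[OF inj, of G] by simp
  also have "\<dots> \<le> (\<Sum>z\<in>H \<times> NZ. G z)"
    using closed by (intro sum_mono2) (auto simp: G_def)
  also have "\<dots> = line_energy f" by (simp add: line_energy_def G_def)
  finally have le: "(\<Sum>i\<in>I. G (\<Phi> i)) \<le> line_energy f" .
  have "(\<Sum>i\<in>I. G (\<Phi> i)) = (\<Sum>(\<omega>, s, \<tau>, r)\<in>I. (line_sum f (P \<omega>) (a \<omega>) (b \<omega>))\<^sup>2)"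
  proof (rule sum.cong[OF refl])
    fix i assume "i \<in> I"
    then obtain \<omega> s \<tau> r where i: "i = (\<omega>, s, \<tau>, r)" "\<omega> \<in> D" "s \<in> ?K" "\<tau> \<in> ?K" "r \<in> ?K" "r \<noteq> \<zero>" "\<tau> \<in> T"
      using T unfolding I_def by blast
    show "G (\<Phi> i) = (case i of (\<omega>, s, \<tau>, r) \<Rightarrow> (line_sum f (P \<omega>) (a \<omega>) (b \<omega>))\<^sup>2)"
      unfolding i(1) G_def \<Phi>_def prod.case
      using line_sum_hstep[OF vshift_closed[OF P[OF i(2)] i(4)] ab[OF i(2)] i(3,5,6)] vshift[OF i(2,7)]
      by simp
  qed
  also have "\<dots> = (\<Sum>\<omega>\<in>D. \<Sum>s\<in>?K. \<Sum>\<tau>\<in>T. \<Sum>r\<in>?K - {\<zero>}. (line_sum f (P \<omega>) (a \<omega>) (b \<omega>))\<^sup>2)"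
    unfolding I_def by (simp add: sum.cartesian_product' card_cartesian_product mult.assoc)
  also have "\<dots> = real (card T) * (real q * (real q - 1)) * (\<Sum>\<omega>\<in>D. (line_sum f (P \<omega>) (a \<omega>) (b \<omega>))\<^sup>2)"
    using q_pos by (simp add: card_Diff_singleton of_nat_diff Suc_leI sum_distrib_left card_cartesian_product mult_ac)
  finally show ?thesis using le by simp
qed

text \<open>The fibre average contributes at most (1 + q) and the mean-zero part at most 2 q times
  its squared norm. The two parts are orthogonal, so these bounds add up, and the constant 4 comes
  from (x + y)^2 \<le> 2 x^2 + 2 y^2.\<close>

lemma L2_estimate:
  assumes fin: "finite D"
    and P: "\<And>\<omega>. \<omega> \<in> D \<Longrightarrow> P \<omega> \<in> H" and ab: "\<And>\<omega>. \<omega> \<in> D \<Longrightarrow> (a \<omega>, b \<omega>) \<in> NZ"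
    and direction: "\<And>\<omega>. \<omega> \<in> D \<Longrightarrow> direction (P \<omega>) (a \<omega>) (b \<omega>) = \<omega>"
  shows "(\<Sum>\<omega>\<in>D. (line_sum f (P \<omega>) (a \<omega>) (b \<omega>))\<^sup>2) \<le> 4 * real q * (\<Sum>p\<in>H. (f p)\<^sup>2)"
proof -
  let ?K = "carrier R"
  define m where "m x y = (\<Sum>t\<in>?K. f (x, y, t)) / real q" for x y
  define f\<^sub>0 where "f\<^sub>0 = (\<lambda>(x, y, t :: 'a). m x y)"
  define f\<^sub>1 where "f\<^sub>1 p = f p - f\<^sub>0 p" for p
  let ?S = "\<lambda>f. \<Sum>p\<in>H. (f p)\<^sup>2"
  let ?E = "\<lambda>f. \<Sum>\<omega>\<in>D. (line_sum f (P \<omega>) (a \<omega>) (b \<omega>))\<^sup>2"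
  have mean0: "(\<Sum>t\<in>?K. f\<^sub>1 (x, y, t)) = 0" for x y
    using q_pos by (simp add: f\<^sub>1_def f\<^sub>0_def m_def sum_subtractf)
  have S: "?S f\<^sub>0 + ?S f\<^sub>1 = ?S f"
  proof -
    have "?S f = (\<Sum>p\<in>H. (f\<^sub>0 p)\<^sup>2 + (f\<^sub>1 p)\<^sup>2 + 2 * f\<^sub>0 p * f\<^sub>1 p)"
      by (simp add: f\<^sub>1_def power2_eq_square algebra_simps)
    also have "\<dots> = ?S f\<^sub>0 + ?S f\<^sub>1 + (\<Sum>p\<in>H. 2 * f\<^sub>0 p * f\<^sub>1 p)"
      by (simp add: sum.distrib)
    also have "(\<Sum>p\<in>H. 2 * f\<^sub>0 p * f\<^sub>1 p) = (\<Sum>x\<in>?K. \<Sum>y\<in>?K. 2 * m x y * (\<Sum>t\<in>?K. f\<^sub>1 (x, y, t)))"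
      unfolding f\<^sub>0_def by (simp add: sum.cartesian_product' sum_distrib_left)
    finally show ?thesis by (simp add: mean0)
  qed
  have qq: "real q * (real q - 1) > 0" using q_ge_2 by simp
  \<comment> \<open>Distinct lifts have unrelated sums of \<open>f\<^sub>1\<close>, so only the
    chosen lift is counted.\<close>
  have "real (card {\<zero>}) * (real q * (real q - 1)) * ?E f\<^sub>1 \<le> line_energy f\<^sub>1"
  proof (rule sum_directions_le_energy[OF fin _ P ab direction])
    fix \<omega> \<tau> assume "\<omega> \<in> D" "\<tau> \<in> {\<zero>}"
    then have "vshift \<tau> (P \<omega>) = P \<omega>" using P[of \<omega>] by (auto simp: vshift_def)
    then show "line_sum f\<^sub>1 (vshift \<tau> (P \<omega>)) (a \<omega>) (b \<omega>) = line_sum f\<^sub>1 (P \<omega>) (a \<omega>) (b \<omega>)"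
      by simp
  qed auto
  also have "\<dots> \<le> (real q * (real q - 1)) * (real q * ?S f\<^sub>1 + real q * ?S f\<^sub>1)"
    unfolding line_energy_eq using qq nbr_form_mean0_le[of f\<^sub>1, OF mean0] by (intro mult_left_mono add_left_mono) auto
  finally have "real q * (real q - 1) * ?E f\<^sub>1 \<le> real q * (real q - 1) * (2 * real q * ?S f\<^sub>1)"
    by (simp add: mult.assoc)
  then have E1: "?E f\<^sub>1 \<le> 2 * real q * ?S f\<^sub>1"
    by (rule mult_left_le_imp_le[OF _ qq])
  \<comment> \<open>Since \<open>f\<^sub>0\<close> is constant along fibres, all q lifts count; the
    extra factor q on the left offsets the q^2 from \<open>nbr_form_le\<close>.\<close>
  have "real q * (real q * (real q - 1)) * ?E f\<^sub>0 \<le> line_energy f\<^sub>0"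
    by (rule sum_directions_le_energy[OF fin subset_refl P ab direction])
      (auto simp: line_sum_def vshift_def hstep_def f\<^sub>0_def case_prod_unfold)
  also have "\<dots> \<le> (real q * (real q - 1)) * (real q * ?S f\<^sub>0 + real q ^ 2 * ?S f\<^sub>0)"
    unfolding line_energy_eq using qq nbr_form_le[of f\<^sub>0] by (intro mult_left_mono add_left_mono) auto
  also have "\<dots> = real q * (real q * (real q - 1)) * ((1 + real q) * ?S f\<^sub>0)"
    by (simp add: algebra_simps power2_eq_square)
  finally have "real q * (real q * (real q - 1)) * ?E f\<^sub>0
      \<le> real q * (real q * (real q - 1)) * ((1 + real q) * ?S f\<^sub>0)" .
  then have E0: "?E f\<^sub>0 \<le> (1 + real q) * ?S f\<^sub>0"
    by (rule mult_left_le_imp_le) (use qq q_pos in simp)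
  have "?E f \<le> (\<Sum>\<omega>\<in>D. 2 * (line_sum f\<^sub>0 (P \<omega>) (a \<omega>) (b \<omega>))\<^sup>2 + 2 * (line_sum f\<^sub>1 (P \<omega>) (a \<omega>) (b \<omega>))\<^sup>2)"
  proof (rule sum_mono)
    fix \<omega>
    have e: "line_sum f (P \<omega>) (a \<omega>) (b \<omega>) = line_sum f\<^sub>0 (P \<omega>) (a \<omega>) (b \<omega>) + line_sum f\<^sub>1 (P \<omega>) (a \<omega>) (b \<omega>)"
      by (simp add: line_sum_def f\<^sub>1_def sum.distrib[symmetric])
    show "(line_sum f (P \<omega>) (a \<omega>) (b \<omega>))\<^sup>2
        \<le> 2 * (line_sum f\<^sub>0 (P \<omega>) (a \<omega>) (b \<omega>))\<^sup>2 + 2 * (line_sum f\<^sub>1 (P \<omega>) (a \<omega>) (b \<omega>))\<^sup>2"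
      unfolding e power2_sum
      using sum_squares_bound[of "line_sum f\<^sub>0 (P \<omega>) (a \<omega>) (b \<omega>)" "line_sum f\<^sub>1 (P \<omega>) (a \<omega>) (b \<omega>)"] by simp
  qed
  also have "\<dots> = 2 * ?E f\<^sub>0 + 2 * ?E f\<^sub>1"
    by (simp add: sum.distrib sum_distrib_left)
  also have "\<dots> \<le> 2 * ((1 + real q) * ?S f\<^sub>0) + 2 * (2 * real q * ?S f\<^sub>1)"
    using E0 E1 by simp
  also have "(1 + real q) * ?S f\<^sub>0 \<le> (2 * real q) * ?S f\<^sub>0"
    using q_pos by (intro mult_right_mono sum_nonneg) auto
  finally show ?thesis unfolding S[symmetric] by (simp add: algebra_simps)
qed

end

section \<open>Interpolation for positive bilinear forms\<close>

text \<open>Weighted AM-GM, applied termwise after normalising by \<open>A\<close> and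
  \<open>B\<close>. Stating it with powers 1 - \<theta> and \<theta> covers both endpoints without
  an infinite exponent.\<close>

lemma sum_powr_Hoelder:
  fixes a b :: "'i \<Rightarrow> real"
  assumes \<theta>: "0 \<le> \<theta>" "\<theta> \<le> 1" and A: "0 < A" and B: "0 < B"
    and nonneg: "\<And>i. i \<in> I \<Longrightarrow> 0 \<le> a i" "\<And>i. i \<in> I \<Longrightarrow> 0 \<le> b i"
    and sums: "sum a I \<le> A" "sum b I \<le> B"
  shows "(\<Sum>i\<in>I. a i powr (1 - \<theta>) * b i powr \<theta>) \<le> A powr (1 - \<theta>) * B powr \<theta>"
proof -
  let ?M = "A powr (1 - \<theta>) * B powr \<theta>"
  have term_le: "a i powr (1 - \<theta>) * b i powr \<theta> \<le> ?M * ((1 - \<theta>) * (a i / A) + \<theta> * (b i / B))"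
    if i: "i \<in> I" for i
  proof (cases "a i = 0 \<or> b i = 0")
    \<comment> \<open>A zero base gives zero even for exponent 0, so the left side vanishes.\<close>
    case True
    then show ?thesis using \<theta> A B nonneg[OF i] by auto
  next
    case False
    then have pos: "a i > 0" "b i > 0" using nonneg[OF i] by auto
    have "a i powr (1 - \<theta>) * b i powr \<theta> = ?M * ((a i / A) powr (1 - \<theta>) * (b i / B) powr \<theta>)"
      using A B pos by (simp add: powr_divide)
    also have "\<dots> \<le> ?M * ((1 - \<theta>) * (a i / A) + \<theta> * (b i / B))"
      using A B pos \<theta> by (intro mult_left_mono Youngs_inequality_0) auto
    finally show ?thesis .
  qed
  have "(\<Sum>i\<in>I. a i powr (1 - \<theta>) * b i powr \<theta>)
      \<le> (\<Sum>i\<in>I. ?M * ((1 - \<theta>) * (a i / A) + \<theta> * (b i / B)))"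
    by (intro sum_mono term_le)
  also have "\<dots> = ?M * ((1 - \<theta>) * (sum a I / A) + \<theta> * (sum b I / B))"
    by (simp only: sum_distrib_left[symmetric] sum.distrib sum_divide_distrib[symmetric])
  also have "\<dots> \<le> ?M * ((1 - \<theta>) * 1 + \<theta> * 1)"
    using A B \<theta> sums by (intro mult_left_mono add_mono) auto
  finally show ?thesis by simp
qed

text \<open>
  With \<open>f = \<phi> powr \<alpha>\<close> and \<open>g = \<psi> powr \<gamma>\<close> this is the norm bound \<open>M\<close> of the bilinear form on
  \<open>\<ell>\<^sup>u \<times> \<ell>\<^sup>w\<close>, \<open>\<alpha> = 1/u\<close>, \<open>\<gamma> = 1/w\<close>, including \<open>u = \<infinity>\<close> or \<open>w = \<infinity>\<close>. Since \<open>0 powr 0 = 0\<close>,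
  \<open>\<phi> powr 0\<close> is the indicator of the support of \<open>\<phi>\<close>.
\<close>

definition form_bound ::
  "'i set \<Rightarrow> 'p set \<Rightarrow> ('i \<Rightarrow> 'p set) \<Rightarrow> real \<Rightarrow> real \<Rightarrow> real \<Rightarrow> bool" where
  "form_bound D P L \<alpha> \<gamma> M \<longleftrightarrow>
     (\<forall>\<phi> \<psi>. (\<forall>p. 0 \<le> \<phi> p) \<and> (\<forall>\<omega>. 0 \<le> \<psi> \<omega>) \<and> sum \<phi> P \<le> 1 \<and> sum \<psi> D \<le> 1 \<longrightarrow>
        (\<Sum>\<omega>\<in>D. \<Sum>p\<in>L \<omega>. \<phi> p powr \<alpha> * \<psi> \<omega> powr \<gamma>) \<le> M)"

lemma form_boundI:
  assumes "\<And>\<phi> \<psi>. (\<And>p. 0 \<le> \<phi> p) \<Longrightarrow> (\<And>\<omega>. 0 \<le> \<psi> \<omega>) \<Longrightarrow> sum \<phi> P \<le> 1 \<Longrightarrow> sum \<psi> D \<le> 1 \<Longrightarrow>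
    (\<Sum>\<omega>\<in>D. \<Sum>p\<in>L \<omega>. \<phi> p powr \<alpha> * \<psi> \<omega> powr \<gamma>) \<le> M"
  shows "form_bound D P L \<alpha> \<gamma> M"
  using assms unfolding form_bound_def by blast

lemma form_boundD:
  assumes "form_bound D P L \<alpha> \<gamma> M"
    and "\<And>p. 0 \<le> \<phi> p" "\<And>\<omega>. 0 \<le> \<psi> \<omega>" "sum \<phi> P \<le> 1" "sum \<psi> D \<le> 1"
  shows "(\<Sum>\<omega>\<in>D. \<Sum>p\<in>L \<omega>. \<phi> p powr \<alpha> * \<psi> \<omega> powr \<gamma>) \<le> M"
  using assms unfolding form_bound_def by blast

text \<open>For a non-negative kernel and monomial test functions, the summand at intermediate
  exponents is exactly the product of powers of the two endpoint summands, so Hoelder over the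
  incidences replaces complex interpolation.\<close>

lemma form_bound_interpolate:
  assumes fin: "finite D" "\<And>\<omega>. \<omega> \<in> D \<Longrightarrow> finite (L \<omega>)"
    and \<theta>: "0 \<le> \<theta>" "\<theta> \<le> 1" and M: "0 < M\<^sub>0" "0 < M\<^sub>1"
    and bnd: "form_bound D P L \<alpha>\<^sub>0 \<gamma>\<^sub>0 M\<^sub>0" "form_bound D P L \<alpha>\<^sub>1 \<gamma>\<^sub>1 M\<^sub>1"
  shows "form_bound D P L ((1 - \<theta>) * \<alpha>\<^sub>0 + \<theta> * \<alpha>\<^sub>1) ((1 - \<theta>) * \<gamma>\<^sub>0 + \<theta> * \<gamma>\<^sub>1)
    (M\<^sub>0 powr (1 - \<theta>) * M\<^sub>1 powr \<theta>)"
proof (rule form_boundI)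
  fix \<phi> :: "'b \<Rightarrow> real" and \<psi> :: "'a \<Rightarrow> real"
  assume nonneg: "\<And>p. 0 \<le> \<phi> p" "\<And>\<omega>. 0 \<le> \<psi> \<omega>" and le1: "sum \<phi> P \<le> 1" "sum \<psi> D \<le> 1"
  define a where "a \<alpha> \<gamma> = (\<lambda>(\<omega>, p). \<phi> p powr \<alpha> * \<psi> \<omega> powr \<gamma>)" for \<alpha> \<gamma>
  have flat: "(\<Sum>\<omega>\<in>D. \<Sum>p\<in>L \<omega>. \<phi> p powr \<alpha> * \<psi> \<omega> powr \<gamma>) = sum (a \<alpha> \<gamma>) (Sigma D L)" for \<alpha> \<gamma>
    using fin by (simp add: a_def sum.Sigma)
  have split: "a ((1 - \<theta>) * \<alpha>\<^sub>0 + \<theta> * \<alpha>\<^sub>1) ((1 - \<theta>) * \<gamma>\<^sub>0 + \<theta> * \<gamma>\<^sub>1) i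
      = a \<alpha>\<^sub>0 \<gamma>\<^sub>0 i powr (1 - \<theta>) * a \<alpha>\<^sub>1 \<gamma>\<^sub>1 i powr \<theta>" for i
    using nonneg by (simp add: a_def case_prod_unfold powr_add powr_mult powr_powr mult_ac)
  show "(\<Sum>\<omega>\<in>D. \<Sum>p\<in>L \<omega>. \<phi> p powr ((1 - \<theta>) * \<alpha>\<^sub>0 + \<theta> * \<alpha>\<^sub>1) *
      \<psi> \<omega> powr ((1 - \<theta>) * \<gamma>\<^sub>0 + \<theta> * \<gamma>\<^sub>1)) \<le> M\<^sub>0 powr (1 - \<theta>) * M\<^sub>1 powr \<theta>"
    unfolding flat split
  proof (rule sum_powr_Hoelder[OF \<theta> M])
    show "sum (a \<alpha>\<^sub>0 \<gamma>\<^sub>0) (Sigma D L) \<le> M\<^sub>0" "sum (a \<alpha>\<^sub>1 \<gamma>\<^sub>1) (Sigma D L) \<le> M\<^sub>1"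
      using form_boundD[OF bnd(1) nonneg le1] form_boundD[OF bnd(2) nonneg le1]
      by (simp_all add: flat)
  qed (auto simp: a_def)
qed

text \<open>Normalised weights are pointwise at most 1, so larger exponents only decrease the
  summands. This is the nesting of the l^p spaces for counting measure.\<close>

lemma form_bound_mono:
  assumes bnd: "form_bound D P L \<alpha> \<gamma> M"
    and fin: "finite D" "finite P" and L: "\<And>\<omega>. \<omega> \<in> D \<Longrightarrow> L \<omega> \<subseteq> P"
    and le: "\<alpha> \<le> \<alpha>'" "\<gamma> \<le> \<gamma>'" "M \<le> M'"
  shows "form_bound D P L \<alpha>' \<gamma>' M'"
proof (rule form_boundI)
  fix \<phi> :: "'b \<Rightarrow> real" and \<psi> :: "'a \<Rightarrow> real"
  assume nonneg: "\<And>p. 0 \<le> \<phi> p" "\<And>\<omega>. 0 \<le> \<psi> \<omega>" and le1: "sum \<phi> P \<le> 1" "sum \<psi> D \<le> 1"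
  have \<phi>: "\<phi> p \<le> 1" if "p \<in> P" for p
    using member_le_sum[OF that _ fin(2), of \<phi>] nonneg le1 by force
  have \<psi>: "\<psi> \<omega> \<le> 1" if "\<omega> \<in> D" for \<omega>
    using member_le_sum[OF that _ fin(1), of \<psi>] nonneg le1 by force
  have "(\<Sum>\<omega>\<in>D. \<Sum>p\<in>L \<omega>. \<phi> p powr \<alpha>' * \<psi> \<omega> powr \<gamma>')
      \<le> (\<Sum>\<omega>\<in>D. \<Sum>p\<in>L \<omega>. \<phi> p powr \<alpha> * \<psi> \<omega> powr \<gamma>)"
    using le nonneg \<phi> \<psi> subsetD[OF L] by (intro sum_mono mult_mono powr_mono') auto
  also have "\<dots> \<le> M'" using form_boundD[OF bnd nonneg le1] le(3) by simp
  finally show "(\<Sum>\<omega>\<in>D. \<Sum>p\<in>L \<omega>. \<phi> p powr \<alpha>' * \<psi> \<omega> powr \<gamma>') \<le> M'" .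
qed

text \<open>Testing with the uniform weight 1 / card D produces the unweighted sum up to the factor
  (card D)^\<gamma>, which is Hoelder's inequality against the constant 1.\<close>

lemma form_bound_gamma_0:
  assumes bnd: "form_bound D P L \<alpha> \<gamma> M" and fin: "finite D" "D \<noteq> {}"
  shows "form_bound D P L \<alpha> 0 (M * real (card D) powr \<gamma>)"
proof (rule form_boundI)
  fix \<phi> :: "'b \<Rightarrow> real" and \<psi> :: "'a \<Rightarrow> real"
  assume nonneg: "\<And>p. 0 \<le> \<phi> p" and le1: "sum \<phi> P \<le> 1"
  have N: "real (card D) > 0" using fin by (simp add: card_gt_0_iff)
  have "(\<Sum>\<omega>\<in>D. \<Sum>p\<in>L \<omega>. \<phi> p powr \<alpha> * \<psi> \<omega> powr 0) \<le> (\<Sum>\<omega>\<in>D. \<Sum>p\<in>L \<omega>. \<phi> p powr \<alpha>)"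
    by (intro sum_mono mult_right_le_one_le) (auto simp: powr_def)
  also have "\<dots> = real (card D) powr \<gamma> * (\<Sum>\<omega>\<in>D. \<Sum>p\<in>L \<omega>. \<phi> p powr \<alpha> * (1 / real (card D)) powr \<gamma>)"
    using N by (simp add: sum_distrib_left powr_divide)
  also have "\<dots> \<le> real (card D) powr \<gamma> * M"
    using N le1 nonneg by (intro mult_left_mono form_boundD[OF bnd]) auto
  finally show "(\<Sum>\<omega>\<in>D. \<Sum>p\<in>L \<omega>. \<phi> p powr \<alpha> * \<psi> \<omega> powr 0) \<le> M * real (card D) powr \<gamma>"
    by (simp add: mult.commute)
qed

section \<open>Directions and choices of lines\<close>

context finite_field
begin

abbreviation "\<D> \<equiv> refined_directions R"

lemma refined_directions_iff:
  "\<omega> \<in> \<D> \<longleftrightarrow> (\<exists>a b c. (a, b) \<in> NZ \<and> c \<in> carrier R \<and> \<omega> = proj_point R a b c)"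
proof -
  have "proj_point R a b c \<in> proj_plane R" if "(a, b) \<in> NZ" "c \<in> carrier R" for a b c
    using that unfolding proj_plane_def proj_point_def
    by (intro quotientI) (auto simp: nonzero_triples_def NZ_iff)
  then show ?thesis unfolding refined_directions_def by blast
qed

lemma proj_point_normalize:
  assumes "(a, b) \<in> NZ" "c \<in> carrier R"
  shows "a \<noteq> \<zero> \<Longrightarrow> proj_point R a b c = proj_point R \<one> (inv a \<otimes> b) (inv a \<otimes> c)"
    and "a = \<zero> \<Longrightarrow> proj_point R a b c = proj_point R \<zero> \<one> (inv b \<otimes> c)"
proof -
  have K: "a \<in> carrier R" "b \<in> carrier R" using assms by (auto simp: NZ_iff)
  show "proj_point R a b c = proj_point R \<one> (inv a \<otimes> b) (inv a \<otimes> c)" if "a \<noteq> \<zero>"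
    using proj_point_scale[OF assms inv_nonzero(1,2)[OF K(1) that]] inv_nonzero(4)[OF K(1) that] by simp
  show "proj_point R a b c = proj_point R \<zero> \<one> (inv b \<otimes> c)" if "a = \<zero>"
  proof -
    have b: "b \<noteq> \<zero>" using that assms by (auto simp: NZ_iff)
    show ?thesis
      using proj_point_scale[OF assms inv_nonzero(1,2)[OF K(2) b]] inv_nonzero[OF K(2) b] that by simp
  qed
qed

lemma refined_directions_subset:
  "\<D> \<subseteq> (\<lambda>(b, c). proj_point R \<one> b c) ` (carrier R \<times> carrier R) \<union> proj_point R \<zero> \<one> ` carrier R"
proof
  fix \<omega> assume "\<omega> \<in> \<D>"
  then obtain a b c where abc: "(a, b) \<in> NZ" "c \<in> carrier R" and \<omega>: "\<omega> = proj_point R a b c"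
    unfolding refined_directions_iff by blast
  have K: "a \<in> carrier R" "b \<in> carrier R" using abc by (auto simp: NZ_iff)
  show "\<omega> \<in> (\<lambda>(b, c). proj_point R \<one> b c) ` (carrier R \<times> carrier R) \<union> proj_point R \<zero> \<one> ` carrier R"
  proof (cases "a = \<zero>")
    case True
    then have "b \<noteq> \<zero>" using abc by (auto simp: NZ_iff)
    then show ?thesis
      using proj_point_normalize(2)[OF abc True] abc inv_nonzero(1)[OF K(2)] unfolding \<omega> by auto
  next
    case False
    have "(inv a \<otimes> b, inv a \<otimes> c) \<in> carrier R \<times> carrier R"
      using inv_nonzero(1)[OF K(1) False] K abc by simp
    then show ?thesis
      using proj_point_normalize(1)[OF abc False] unfolding \<omega> by (intro UnI1 image_eqI) auto
  qed
qed

lemma finite_directions [simp, intro]: "finite \<D>"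
  by (rule finite_subset[OF refined_directions_subset]) auto

text \<open>The charts a = 1 and a = 0, b = 1 contribute at most q^2 and q points; the sum is
  rounded up to a multiple of a pure power.\<close>

lemma card_directions_le: "real (card \<D>) \<le> 2 * real q ^ 2"
proof -
  have "card \<D> \<le> card ((\<lambda>(b, c). proj_point R \<one> b c) ` (carrier R \<times> carrier R) \<union> proj_point R \<zero> \<one> ` carrier R)"
    by (rule card_mono[OF _ refined_directions_subset]) auto
  also have "\<dots> \<le> card (carrier R \<times> carrier R) + q"
    by (intro order.trans[OF card_Un_le] add_mono card_image_le) auto
  also have "\<dots> \<le> q * q + q * q"
    using q_pos by (simp add: card_cartesian_product)
  finally show ?thesis by (simp add: power2_eq_square flip: of_nat_mult of_nat_add)
qed

lemma direction_mem: "p \<in> H \<Longrightarrow> (a, b) \<in> NZ \<Longrightarrow> direction p a b \<in> \<D>"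
  unfolding direction_def refined_directions_iff
  by (intro exI[of _ a] exI[of _ b] exI[of _ "fst p \<otimes> b \<ominus> fst (snd p) \<otimes> a"]) (auto simp: NZ_iff)

lemma directions_nonempty: "\<D> \<noteq> {}"
proof -
  have "direction (\<zero>, \<zero>, \<zero>) \<one> \<zero> \<in> \<D>" by (rule direction_mem) (auto simp: NZ_iff)
  then show ?thesis by blast
qed

lemma Dir_hline_direction: "p \<in> H \<Longrightarrow> (a, b) \<in> NZ \<Longrightarrow> Dir R (hline R p a b) = direction p a b"
  using Dir_hline by (cases p) (auto simp: carrier_heis direction_def)

lemma horizontal_lines_iff:
  "l \<in> horizontal_lines R \<longleftrightarrow> (\<exists>p a b. p \<in> H \<and> (a, b) \<in> NZ \<and> l = hline R p a b)"
  unfolding horizontal_lines_def carrier_heis by blast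

lemma hline_subset:
  assumes "p \<in> H" "(a, b) \<in> NZ"
  shows "hline R p a b \<subseteq> H"
proof -
  have K: "a \<in> carrier R" "b \<in> carrier R" using assms by (auto simp: NZ_iff)
  show ?thesis unfolding hline_hstep[OF assms(1) K]
    using assms(1) K by (intro image_subsetI hstep_closed) auto
qed

lemma horizontal_line_subset: "l \<in> horizontal_lines R \<Longrightarrow> l \<subseteq> H"
  unfolding horizontal_lines_iff using hline_subset by blast

text \<open>A base point is found by solving x b - y a = c with one of x and y equal to zero. Hence
  the maximum defining the operator runs over a non-empty set.\<close>

lemma direction_has_line:
  assumes "\<omega> \<in> \<D>"
  shows "\<exists>l\<in>horizontal_lines R. Dir R l = \<omega>"
proof -
  obtain a b c where abc: "(a, b) \<in> NZ" "c \<in> carrier R" and \<omega>: "\<omega> = proj_point R a b c"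
    using assms unfolding refined_directions_iff by blast
  have K: "a \<in> carrier R" "b \<in> carrier R" using abc by (auto simp: NZ_iff)
  have "\<exists>p\<in>H. direction p a b = \<omega>"
  proof (cases "a = \<zero>")
    case True
    then have b: "b \<noteq> \<zero>" using abc by (auto simp: NZ_iff)
    note i = inv_nonzero[OF K(2) b]
    have "c \<otimes> inv b \<otimes> b \<ominus> \<zero> \<otimes> a = c" using i abc K by (simp add: m_assoc minus_eq)
    then show ?thesis using i abc K unfolding direction_def \<omega>
      by (intro bexI[of _ "(c \<otimes> inv b, \<zero>, \<zero>)"]) auto
  next
    case False
    note i = inv_nonzero[OF K(1) False]
    have "\<zero> \<otimes> b \<ominus> (\<ominus> (c \<otimes> inv a)) \<otimes> a = c" using i abc K by (simp add: m_assoc minus_eq l_minus)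
    then show ?thesis using i abc K unfolding direction_def \<omega>
      by (intro bexI[of _ "(\<zero>, \<ominus> (c \<otimes> inv a), \<zero>)"]) auto
  qed
  then show ?thesis using abc(1) unfolding horizontal_lines_iff
    by (metis Dir_hline_direction horizontal_lines_iff)
qed

end

text \<open>Keeping the selector arbitrary makes every estimate uniform in it, as is required when
  the maximising lines depend on the function.\<close>

locale line_choice = finite_field +
  fixes L :: "('a \<times> 'a \<times> 'a) set \<Rightarrow> ('a \<times> 'a \<times> 'a) set"
  assumes line: "\<omega> \<in> \<D> \<Longrightarrow> L \<omega> \<in> horizontal_lines R"
    and line_direction: "\<omega> \<in> \<D> \<Longrightarrow> Dir R (L \<omega>) = \<omega>"
begin

lemma L_subset: "\<omega> \<in> \<D> \<Longrightarrow> L \<omega> \<subseteq> H"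
  using line horizontal_line_subset by blast

lemma finite_L: "\<omega> \<in> \<D> \<Longrightarrow> finite (L \<omega>)"
  by (rule finite_subset[OF L_subset]) auto

lemma line_params:
  obtains P a b where "\<And>\<omega>. \<omega> \<in> \<D> \<Longrightarrow> P \<omega> \<in> H" "\<And>\<omega>. \<omega> \<in> \<D> \<Longrightarrow> (a \<omega>, b \<omega>) \<in> NZ"
    "\<And>\<omega>. \<omega> \<in> \<D> \<Longrightarrow> L \<omega> = hline R (P \<omega>) (a \<omega>) (b \<omega>)"
    "\<And>\<omega>. \<omega> \<in> \<D> \<Longrightarrow> direction (P \<omega>) (a \<omega>) (b \<omega>) = \<omega>"
proof -
  have "\<forall>\<omega>\<in>\<D>. \<exists>z. fst z \<in> H \<and> snd z \<in> NZ \<and> L \<omega> = hline R (fst z) (fst (snd z)) (snd (snd z))"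
    using line unfolding horizontal_lines_iff by fastforce
  then obtain f where f: "\<And>\<omega>. \<omega> \<in> \<D> \<Longrightarrow> fst (f \<omega>) \<in> H \<and> snd (f \<omega>) \<in> NZ \<and>
      L \<omega> = hline R (fst (f \<omega>)) (fst (snd (f \<omega>))) (snd (snd (f \<omega>)))"
    using bchoice[OF \<open>\<forall>\<omega>\<in>\<D>. _ \<omega>\<close>] by blast
  show thesis
  proof (rule that)
    fix \<omega> assume \<omega>: "\<omega> \<in> \<D>"
    show *: "fst (f \<omega>) \<in> H" "(fst (snd (f \<omega>)), snd (snd (f \<omega>))) \<in> NZ"
      "L \<omega> = hline R (fst (f \<omega>)) (fst (snd (f \<omega>))) (snd (snd (f \<omega>)))"
      using f[OF \<omega>] by auto
    show "direction (fst (f \<omega>)) (fst (snd (f \<omega>))) (snd (snd (f \<omega>))) = \<omega>"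
      using Dir_hline_direction[OF *(1,2)] line_direction[OF \<omega>] *(3) by simp
  qed
qed

lemma card_L_le:
  assumes "\<omega> \<in> \<D>"
  shows "card (L \<omega>) \<le> q"
proof -
  obtain p a b where "L \<omega> = hline R p a b"
    using line[OF assms] unfolding horizontal_lines_iff by blast
  then show ?thesis unfolding hline_def by (simp only: card_image_le[OF finite_carrier])
qed

lemma L2_bound: "(\<Sum>\<omega>\<in>\<D>. (\<Sum>p\<in>L \<omega>. f p)\<^sup>2) \<le> 4 * real q * (\<Sum>p\<in>H. (f p)\<^sup>2)"
proof -
  obtain P a b where P: "\<And>\<omega>. \<omega> \<in> \<D> \<Longrightarrow> P \<omega> \<in> H" "\<And>\<omega>. \<omega> \<in> \<D> \<Longrightarrow> (a \<omega>, b \<omega>) \<in> NZ"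
    "\<And>\<omega>. \<omega> \<in> \<D> \<Longrightarrow> L \<omega> = hline R (P \<omega>) (a \<omega>) (b \<omega>)"
    "\<And>\<omega>. \<omega> \<in> \<D> \<Longrightarrow> direction (P \<omega>) (a \<omega>) (b \<omega>) = \<omega>"
    using line_params by blast
  have "(\<Sum>\<omega>\<in>\<D>. (\<Sum>p\<in>L \<omega>. f p)\<^sup>2) = (\<Sum>\<omega>\<in>\<D>. (line_sum f (P \<omega>) (a \<omega>) (b \<omega>))\<^sup>2)"
    by (intro sum.cong refl) (simp only: P sum_hline)
  then show ?thesis using L2_estimate[OF finite_directions P(1,2,4)] by simp
qed

text \<open>A line through (x, y, t) with step (a, b) has direction [a : b : x b - y a], so the
  point and the slope determine it; there are q + 1 slopes.\<close>

lemma card_directions_through: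
  assumes p: "p \<in> H"
  shows "card {\<omega> \<in> \<D>. p \<in> L \<omega>} \<le> q + 1"
proof -
  obtain x y t where pe: "p = (x, y, t)" by (cases p)
  then have xy: "x \<in> carrier R" "y \<in> carrier R" using p by auto
  have "{\<omega> \<in> \<D>. p \<in> L \<omega>} \<subseteq> (\<lambda>b. proj_point R \<one> b (x \<otimes> b \<ominus> y)) ` carrier R \<union> {proj_point R \<zero> \<one> x}"
    (is "_ \<subseteq> ?A")
  proof
    fix \<omega> assume "\<omega> \<in> {\<omega> \<in> \<D>. p \<in> L \<omega>}"
    then have \<omega>: "\<omega> \<in> \<D>" "p \<in> L \<omega>" by auto
    obtain P a b where P: "P \<in> H" "(a, b) \<in> NZ" "L \<omega> = hline R P a b" and d: "direction P a b = \<omega>"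
      using line[OF \<omega>(1)] line_direction[OF \<omega>(1)] Dir_hline_direction unfolding horizontal_lines_iff by metis
    have K: "a \<in> carrier R" "b \<in> carrier R" using P by (auto simp: NZ_iff)
    obtain s where s: "s \<in> carrier R" "p = hstep (s \<otimes> a) (s \<otimes> b) P"
      using \<omega>(2) unfolding P(3) hline_hstep[OF P(1) K] by blast
    have "direction p a b = \<omega>"
      using direction_hstep[OF P(1,2) s(1) one_closed] d K unfolding s(2) by simp
    then have e: "\<omega> = proj_point R a b (x \<otimes> b \<ominus> y \<otimes> a)" by (simp add: direction_def pe)
    show "\<omega> \<in> ?A"
    proof (cases "a = \<zero>")
      case True
      then have b: "b \<noteq> \<zero>" using P(2) by (auto simp: NZ_iff)
      have "inv b \<otimes> (x \<otimes> b \<ominus> y \<otimes> a) = x"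
        using True xy K inv_cancel(1)[OF K(2) b xy(1)] by (simp add: minus_eq m_comm)
      then have "\<omega> = proj_point R \<zero> \<one> x"
        using proj_point_normalize(2)[OF P(2) _ True, of "x \<otimes> b \<ominus> y \<otimes> a"] xy K e by simp
      then show ?thesis by blast
    next
      case False
      note i = inv_nonzero[OF K(1) False]
      have "inv a \<otimes> (x \<otimes> b \<ominus> y \<otimes> a) = x \<otimes> (inv a \<otimes> b) \<ominus> y \<otimes> (inv a \<otimes> a)"
        using xy K i(1) by algebra
      also have "\<dots> = x \<otimes> (inv a \<otimes> b) \<ominus> y" using i xy by simp
      finally have "\<omega> = proj_point R \<one> (inv a \<otimes> b) (x \<otimes> (inv a \<otimes> b) \<ominus> y)"
        using proj_point_normalize(1)[OF P(2) _ False, of "x \<otimes> b \<ominus> y \<otimes> a"] xy K e by simp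
      then show ?thesis using i K by blast
    qed
  qed
  then have "card {\<omega> \<in> \<D>. p \<in> L \<omega>}
      \<le> card ((\<lambda>b. proj_point R \<one> b (x \<otimes> b \<ominus> y)) ` carrier R \<union> {proj_point R \<zero> \<one> x})"
    by (intro card_mono) auto
  also have "\<dots> \<le> q + 1"
    by (intro order.trans[OF card_Un_le] add_mono card_image_le) auto
  finally show ?thesis .
qed

section \<open>The four vertex estimates; the names give \<open>(u, v)\<close>, the forms carry
  \<open>1/u\<close> and \<open>1 - 1/v\<close>\<close>

lemma bound_infinity_infinity: "form_bound \<D> H L 0 1 (real q)"
proof (rule form_boundI)
  fix \<phi> \<psi> :: "_ \<Rightarrow> real"
  assume nonneg: "\<And>\<omega>. 0 \<le> \<psi> \<omega>" and le1: "sum \<psi> \<D> \<le> 1"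
  have "(\<Sum>\<omega>\<in>\<D>. \<Sum>p\<in>L \<omega>. \<phi> p powr 0 * \<psi> \<omega> powr 1) \<le> (\<Sum>\<omega>\<in>\<D>. real q * \<psi> \<omega>)"
  proof (rule sum_mono)
    fix \<omega> assume \<omega>: "\<omega> \<in> \<D>"
    have "(\<Sum>p\<in>L \<omega>. \<phi> p powr 0 * \<psi> \<omega> powr 1) \<le> (\<Sum>p\<in>L \<omega>. \<psi> \<omega>)"
      using nonneg[of \<omega>] by (intro sum_mono) (simp add: powr_def)
    also have "\<dots> \<le> real q * \<psi> \<omega>"
      using card_L_le[OF \<omega>] nonneg[of \<omega>] by (simp add: mult_right_mono)
    finally show "(\<Sum>p\<in>L \<omega>. \<phi> p powr 0 * \<psi> \<omega> powr 1) \<le> real q * \<psi> \<omega>" .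
  qed
  also have "\<dots> = real q * sum \<psi> \<D>" by (simp add: sum_distrib_left)
  also have "\<dots> \<le> real q" using le1 by (simp add: mult_left_le)
  finally show "(\<Sum>\<omega>\<in>\<D>. \<Sum>p\<in>L \<omega>. \<phi> p powr 0 * \<psi> \<omega> powr 1) \<le> real q" .
qed

lemma bound_1_infinity: "form_bound \<D> H L 1 1 1"
proof (rule form_boundI)
  fix \<phi> \<psi> :: "_ \<Rightarrow> real"
  assume nonneg: "\<And>p. 0 \<le> \<phi> p" "\<And>\<omega>. 0 \<le> \<psi> \<omega>" and le1: "sum \<phi> H \<le> 1" "sum \<psi> \<D> \<le> 1"
  have "(\<Sum>\<omega>\<in>\<D>. \<Sum>p\<in>L \<omega>. \<phi> p powr 1 * \<psi> \<omega> powr 1) = (\<Sum>\<omega>\<in>\<D>. sum \<phi> (L \<omega>) * \<psi> \<omega>)"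
    using nonneg by (simp add: sum_distrib_right)
  also have "\<dots> \<le> (\<Sum>\<omega>\<in>\<D>. 1 * \<psi> \<omega>)"
  proof (intro sum_mono mult_right_mono nonneg(2))
    fix \<omega> assume "\<omega> \<in> \<D>"
    then have "sum \<phi> (L \<omega>) \<le> sum \<phi> H"
      using nonneg L_subset by (intro sum_mono2) auto
    then show "sum \<phi> (L \<omega>) \<le> 1" using le1 by simp
  qed
  finally show "(\<Sum>\<omega>\<in>\<D>. \<Sum>p\<in>L \<omega>. \<phi> p powr 1 * \<psi> \<omega> powr 1) \<le> 1" using le1 by simp
qed

text \<open>Double counting of incidences: each point lies on at most q + 1 \<le> 2 q of the chosen
  lines.\<close>

lemma bound_1_1: "form_bound \<D> H L 1 0 (2 * real q)"
proof (rule form_boundI)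
  fix \<phi> \<psi> :: "_ \<Rightarrow> real"
  assume nonneg: "\<And>p. 0 \<le> \<phi> p" and le1: "sum \<phi> H \<le> 1"
  have "(\<Sum>\<omega>\<in>\<D>. \<Sum>p\<in>L \<omega>. \<phi> p powr 1 * \<psi> \<omega> powr 0) \<le> (\<Sum>\<omega>\<in>\<D>. \<Sum>p\<in>L \<omega>. \<phi> p)"
    using nonneg by (intro sum_mono) simp
  also have "\<dots> = (\<Sum>\<omega>\<in>\<D>. \<Sum>p\<in>H. if p \<in> L \<omega> then \<phi> p else 0)"
  proof (rule sum.cong[OF refl])
    fix \<omega> assume "\<omega> \<in> \<D>"
    then have "H \<inter> L \<omega> = L \<omega>" using L_subset by blast
    then show "(\<Sum>p\<in>L \<omega>. \<phi> p) = (\<Sum>p\<in>H. if p \<in> L \<omega> then \<phi> p else 0)"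
      by (simp add: sum.inter_restrict[symmetric])
  qed
  also have "\<dots> = (\<Sum>p\<in>H. \<Sum>\<omega>\<in>\<D>. if p \<in> L \<omega> then \<phi> p else 0)"
    by (rule sum.swap)
  also have "\<dots> = (\<Sum>p\<in>H. real (card {\<omega> \<in> \<D>. p \<in> L \<omega>}) * \<phi> p)"
    by (intro sum.cong refl) (simp add: sum.inter_filter[symmetric])
  also have "\<dots> \<le> (\<Sum>p\<in>H. 2 * real q * \<phi> p)"
  proof (intro sum_mono mult_right_mono nonneg)
    fix p assume "p \<in> H"
    then show "real (card {\<omega> \<in> \<D>. p \<in> L \<omega>}) \<le> 2 * real q"
      using card_directions_through[of p] q_pos by linarith
  qed
  also have "\<dots> \<le> 2 * real q"
    using le1 by (simp add: sum_distrib_left[symmetric] mult_left_le)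
  finally show "(\<Sum>\<omega>\<in>\<D>. \<Sum>p\<in>L \<omega>. \<phi> p powr 1 * \<psi> \<omega> powr 0) \<le> 2 * real q" .
qed

text \<open>Cauchy-Schwarz over the directions reduces the form to the quadratic estimate; the
  constant is the square root of 4 q.\<close>

lemma bound_2_2: "form_bound \<D> H L (1/2) (1/2) (2 * real q powr (1/2))"
proof (rule form_boundI)
  fix \<phi> \<psi> :: "_ \<Rightarrow> real"
  assume nonneg: "\<And>p. 0 \<le> \<phi> p" "\<And>\<omega>. 0 \<le> \<psi> \<omega>" and le1: "sum \<phi> H \<le> 1" "sum \<psi> \<D> \<le> 1"
  let ?T = "\<lambda>\<omega>. \<Sum>p\<in>L \<omega>. sqrt (\<phi> p)"
  have "(\<Sum>\<omega>\<in>\<D>. ?T \<omega> * sqrt (\<psi> \<omega>))\<^sup>2 \<le> (\<Sum>\<omega>\<in>\<D>. (?T \<omega>)\<^sup>2) * (\<Sum>\<omega>\<in>\<D>. (sqrt (\<psi> \<omega>))\<^sup>2)"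
    by (rule Cauchy_Schwarz_ineq_sum)
  also have "\<dots> \<le> (4 * real q * (\<Sum>p\<in>H. (sqrt (\<phi> p))\<^sup>2)) * 1"
    using le1 nonneg by (intro mult_mono L2_bound) (auto intro!: sum_nonneg mult_nonneg_nonneg)
  also have "\<dots> \<le> 4 * real q"
    using le1 nonneg by (simp add: mult_left_le)
  finally have "(\<Sum>\<omega>\<in>\<D>. ?T \<omega> * sqrt (\<psi> \<omega>)) \<le> sqrt (4 * real q)"
    by (rule real_le_rsqrt)
  then show "(\<Sum>\<omega>\<in>\<D>. \<Sum>p\<in>L \<omega>. \<phi> p powr (1/2) * \<psi> \<omega> powr (1/2)) \<le> 2 * real q powr (1/2)"
    using nonneg by (simp add: powr_half_sqrt sum_distrib_right real_sqrt_mult)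
qed

end

section \<open>Admissible exponents\<close>

text \<open>Here \<alpha> = 1/u and \<beta> = 1/v, and 1 - \<beta> is the dual exponent because
  \<psi> tests the l^v norm. \<open>C\<close> is fixed before the field and the lines.\<close>

definition admissible :: "real \<Rightarrow> real \<Rightarrow> real \<Rightarrow> bool" where
  "admissible \<alpha> \<beta> A \<longleftrightarrow> (\<exists>C>0. \<forall>(R :: nat ring) L. line_choice R L \<longrightarrow>
     form_bound (refined_directions R) (carrier R \<times> carrier R \<times> carrier R) L \<alpha> (1 - \<beta>)
       (C * real (card (carrier R)) powr A))"

lemma admissibleI:
  assumes "0 < C"
    and "\<And>(R :: nat ring) L. line_choice R L \<Longrightarrow>
      form_bound (refined_directions R) (carrier R \<times> carrier R \<times> carrier R) L \<alpha> (1 - \<beta>)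
        (C * real (card (carrier R)) powr A)"
  shows "admissible \<alpha> \<beta> A"
  using assms unfolding admissible_def by blast

text \<open>Constants interpolate geometrically and so remain independent of q, while the power of q
  interpolates affinely: the admissible triples form a convex set.\<close>

lemma admissible_interpolate:
  assumes "admissible \<alpha>\<^sub>0 \<beta>\<^sub>0 A\<^sub>0" "admissible \<alpha>\<^sub>1 \<beta>\<^sub>1 A\<^sub>1" and \<theta>: "0 \<le> \<theta>" "\<theta> \<le> 1"
    and eq: "\<alpha> = (1 - \<theta>) * \<alpha>\<^sub>0 + \<theta> * \<alpha>\<^sub>1" "\<beta> = (1 - \<theta>) * \<beta>\<^sub>0 + \<theta> * \<beta>\<^sub>1" "A = (1 - \<theta>) * A\<^sub>0 + \<theta> * A\<^sub>1"
  shows "admissible \<alpha> \<beta> A"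
proof -
  obtain C\<^sub>0 C\<^sub>1 where C: "C\<^sub>0 > 0" "C\<^sub>1 > 0" and
    bnd: "\<And>(R :: nat ring) L. line_choice R L \<Longrightarrow>
      form_bound (refined_directions R) (carrier R \<times> carrier R \<times> carrier R) L \<alpha>\<^sub>0 (1 - \<beta>\<^sub>0)
        (C\<^sub>0 * real (card (carrier R)) powr A\<^sub>0)"
      "\<And>(R :: nat ring) L. line_choice R L \<Longrightarrow>
      form_bound (refined_directions R) (carrier R \<times> carrier R \<times> carrier R) L \<alpha>\<^sub>1 (1 - \<beta>\<^sub>1)
        (C\<^sub>1 * real (card (carrier R)) powr A\<^sub>1)"
    using assms(1,2) unfolding admissible_def by blast
  show ?thesis
  proof (rule admissibleI)
    show "0 < C\<^sub>0 powr (1 - \<theta>) * C\<^sub>1 powr \<theta>" using C by simp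
    fix R :: "nat ring" and L assume lc: "line_choice R L"
    interpret line_choice R L by (rule lc)
    have q: "real q > 0" using q_pos by simp
    have pos: "0 < C\<^sub>0 * real q powr A\<^sub>0" "0 < C\<^sub>1 * real q powr A\<^sub>1"
      using C q by (auto intro!: mult_pos_pos)
    have M: "(C\<^sub>0 * real q powr A\<^sub>0) powr (1 - \<theta>) * (C\<^sub>1 * real q powr A\<^sub>1) powr \<theta>
        = C\<^sub>0 powr (1 - \<theta>) * C\<^sub>1 powr \<theta> * real q powr A"
      using C by (simp add: powr_mult powr_powr eq(3) powr_add mult_ac)
    have "1 - \<beta> = (1 - \<theta>) * (1 - \<beta>\<^sub>0) + \<theta> * (1 - \<beta>\<^sub>1)" by (simp add: eq(2) algebra_simps)
    then show "form_bound \<D> H L \<alpha> (1 - \<beta>) (C\<^sub>0 powr (1 - \<theta>) * C\<^sub>1 powr \<theta> * real q powr A)"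
      using form_bound_interpolate[OF finite_directions finite_L \<theta> pos bnd(1)[OF lc] bnd(2)[OF lc]]
      unfolding M eq(1) by simp
  qed
qed

text \<open>Raising \<alpha> decreases u and increases the norm of the function; lowering \<beta>
  increases v and decreases the norm of the maximal function.\<close>

lemma admissible_mono:
  assumes "admissible \<alpha> \<beta> A" "\<alpha> \<le> \<alpha>'" "\<beta>' \<le> \<beta>" "A \<le> A'"
  shows "admissible \<alpha>' \<beta>' A'"
proof -
  obtain C where C: "C > 0" and
    bnd: "\<And>(R :: nat ring) L. line_choice R L \<Longrightarrow>
      form_bound (refined_directions R) (carrier R \<times> carrier R \<times> carrier R) L \<alpha> (1 - \<beta>)
        (C * real (card (carrier R)) powr A)"
    using assms(1) unfolding admissible_def by blast
  show ?thesis
  proof (rule admissibleI[OF C])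
    fix R :: "nat ring" and L assume lc: "line_choice R L"
    interpret line_choice R L by (rule lc)
    have "real q powr A \<le> real q powr A'"
      using q_ge_2 assms(4) by (intro powr_mono) auto
    then show "form_bound \<D> H L \<alpha>' (1 - \<beta>') (C * real q powr A')"
      using assms C by (intro form_bound_mono[OF bnd[OF lc]] L_subset) auto
  qed
qed

lemma admissible_beta_1:
  assumes "admissible \<alpha> \<beta> A" "\<beta> \<le> 1"
  shows "admissible \<alpha> 1 (A + 2 * (1 - \<beta>))"
proof -
  obtain C where C: "C > 0" and
    bnd: "\<And>(R :: nat ring) L. line_choice R L \<Longrightarrow>
      form_bound (refined_directions R) (carrier R \<times> carrier R \<times> carrier R) L \<alpha> (1 - \<beta>)
        (C * real (card (carrier R)) powr A)"
    using assms(1) unfolding admissible_def by blast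
  show ?thesis
  proof (rule admissibleI)
    show "0 < C * 2 powr (1 - \<beta>)" using C by simp
    fix R :: "nat ring" and L assume lc: "line_choice R L"
    interpret line_choice R L by (rule lc)
    have q: "real q > 0" using q_pos by simp
    have "real (card \<D>) powr (1 - \<beta>) \<le> (2 * real q ^ 2) powr (1 - \<beta>)"
      using card_directions_le assms(2) by (intro powr_mono2) auto
    also have "\<dots> = 2 powr (1 - \<beta>) * real q powr (2 * (1 - \<beta>))"
      using q by (simp add: powr_mult powr_powr flip: powr_numeral)
    finally have "C * real q powr A * real (card \<D>) powr (1 - \<beta>)
        \<le> C * real q powr A * (2 powr (1 - \<beta>) * real q powr (2 * (1 - \<beta>)))"
      using C by (intro mult_left_mono) auto
    also have "\<dots> = C * 2 powr (1 - \<beta>) * real q powr (A + 2 * (1 - \<beta>))"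
      by (simp add: powr_add)
    finally show "form_bound \<D> H L \<alpha> (1 - 1) (C * 2 powr (1 - \<beta>) * real q powr (A + 2 * (1 - \<beta>)))"
      by (intro form_bound_mono[OF form_bound_gamma_0[OF bnd[OF lc] finite_directions directions_nonempty]] L_subset) auto
  qed
qed

lemma admissible_vertices:
  "admissible 0 0 1" "admissible 1 0 0" "admissible 1 1 1" "admissible (1/2) (1/2) (1/2)"
proof -
  have "form_bound (refined_directions R) (carrier R \<times> carrier R \<times> carrier R) L 0 (1 - 0)
      (1 * real (card (carrier R)) powr 1)"
    "form_bound (refined_directions R) (carrier R \<times> carrier R \<times> carrier R) L 1 (1 - 0)
      (1 * real (card (carrier R)) powr 0)"
    "form_bound (refined_directions R) (carrier R \<times> carrier R \<times> carrier R) L 1 (1 - 1)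
      (2 * real (card (carrier R)) powr 1)"
    "form_bound (refined_directions R) (carrier R \<times> carrier R \<times> carrier R) L (1/2) (1 - 1/2)
      (2 * real (card (carrier R)) powr (1/2))"
    if "line_choice R L" for R :: "nat ring" and L
  proof -
    interpret line_choice R L by (rule that)
    show "form_bound \<D> H L 0 (1 - 0) (1 * real q powr 1)" "form_bound \<D> H L 1 (1 - 0) (1 * real q powr 0)"
      "form_bound \<D> H L 1 (1 - 1) (2 * real q powr 1)" "form_bound \<D> H L (1/2) (1 - 1/2) (2 * real q powr (1/2))"
      using bound_infinity_infinity bound_1_infinity bound_1_1 bound_2_2 q_pos by auto
  qed
  then show "admissible 0 0 1" "admissible 1 0 0" "admissible 1 1 1" "admissible (1/2) (1/2) (1/2)"
    by (auto intro: admissibleI[of 1] admissibleI[of 2])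
qed

text \<open>The bend at 1/2 comes from interpolating on two segments that meet at the quadratic
  estimate.\<close>

lemma admissible_diagonal:
  assumes "0 \<le> \<alpha>" "\<alpha> \<le> 1"
  shows "admissible \<alpha> \<alpha> (max \<alpha> (1 - \<alpha>))"
proof (cases "\<alpha> \<le> 1/2")
  case True
  then show ?thesis using assms
    by (intro admissible_interpolate[OF admissible_vertices(1,4), of "2 * \<alpha>"]) (auto simp: field_simps max_def)
next
  case False
  then show ?thesis using assms
    by (intro admissible_interpolate[OF admissible_vertices(4,3), of "2 * \<alpha> - 1"]) (auto simp: field_simps max_def)
qed

lemma admissible_antidiagonal:
  assumes "1/2 \<le> \<alpha>" "\<alpha> \<le> 1"
  shows "admissible \<alpha> (1 - \<alpha>) (1 - \<alpha>)"
  using assms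
  by (intro admissible_interpolate[OF admissible_vertices(4,2), of "2 * \<alpha> - 1"]) (auto simp: field_simps)

definition rd_exponent :: "real \<Rightarrow> real \<Rightarrow> real" where
  "rd_exponent \<alpha> \<beta> = Max {\<beta>, 1 - \<alpha>, 2 * \<beta> - \<alpha>, 1 + 2 * \<beta> - 3 * \<alpha>}"

lemma rd_exponent_ge:
  "\<beta> \<le> rd_exponent \<alpha> \<beta>" "1 - \<alpha> \<le> rd_exponent \<alpha> \<beta>" "2 * \<beta> - \<alpha> \<le> rd_exponent \<alpha> \<beta>"
  "1 + 2 * \<beta> - 3 * \<alpha> \<le> rd_exponent \<alpha> \<beta>"
  by (auto simp: rd_exponent_def intro!: Max_ge)

text \<open>For \<beta> \<ge> \<alpha> the exponent is the diagonal value plus 2 (\<beta> -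
  \<alpha>), linear in \<beta> up to v = 1. For \<beta> \<le> \<alpha> it is max \<beta> (1 -
  \<alpha>), which is constant along the free moves of increasing \<alpha> or decreasing \<beta>
  from a suitable point of the diagonal or of the segment from (1/2, 1/2) to (1, 0).\<close>

lemma admissible_rd_exponent:
  assumes \<alpha>: "0 \<le> \<alpha>" "\<alpha> \<le> 1" and \<beta>: "0 \<le> \<beta>" "\<beta> \<le> 1"
  shows "admissible \<alpha> \<beta> (rd_exponent \<alpha> \<beta>)"
proof -
  note ge = rd_exponent_ge[of \<beta> \<alpha>] rd_exponent_ge(2-4)[of \<alpha> \<beta>]
  consider "\<alpha> = 1" "\<beta> = 1" | "\<alpha> < 1" "\<alpha> \<le> \<beta>" | "\<beta> \<le> \<alpha>" "1 - \<beta> \<le> \<alpha>" "1/2 \<le> \<beta>"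
    | "\<beta> \<le> \<alpha>" "1 - \<beta> \<le> \<alpha>" "\<beta> \<le> 1/2" | "\<beta> \<le> \<alpha>" "\<alpha> \<le> 1 - \<beta>" "\<alpha> \<le> 1/2"
    | "\<beta> \<le> \<alpha>" "\<alpha> \<le> 1 - \<beta>" "1/2 \<le> \<alpha>"
    using assms by linarith
  then show ?thesis
  proof cases
    case 1
    show ?thesis
      by (rule admissible_mono[OF admissible_vertices(3)]) (use 1 ge in auto)
  next
    case 2
    \<comment> \<open>Solves (1 - \<theta>) \<alpha> + \<theta> = \<beta> on the vertical segment
      from (\<alpha>, \<alpha>) to (\<alpha>, 1); the corner \<alpha> = 1 is split off because of
      the denominator.\<close>
    define \<theta> where "\<theta> = (\<beta> - \<alpha>) / (1 - \<alpha>)"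
    have \<theta>: "0 \<le> \<theta>" "\<theta> \<le> 1" "\<theta> * (1 - \<alpha>) = \<beta> - \<alpha>" using 2 \<beta> by (auto simp: \<theta>_def)
    let ?A = "max \<alpha> (1 - \<alpha>)"
    note d = admissible_diagonal[OF \<alpha>]
    have "admissible \<alpha> \<beta> (?A + 2 * (\<beta> - \<alpha>))"
      by (rule admissible_interpolate[OF d admissible_beta_1[OF d \<alpha>(2)] \<theta>(1,2)])
        (use \<theta>(3) in \<open>auto simp: algebra_simps\<close>)
    then show ?thesis
      by (rule admissible_mono) (use ge in \<open>auto simp: max_def\<close>)
  next
    case 3
    show ?thesis
      by (rule admissible_mono[OF admissible_diagonal[OF \<beta>]]) (use 3 ge in auto)
  next
    case 4
    show ?thesis
      by (rule admissible_mono[OF admissible_antidiagonal[of "1 - \<beta>"]]) (use 4 \<beta> ge in auto)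
  next
    case 5
    show ?thesis
      by (rule admissible_mono[OF admissible_diagonal[OF \<alpha>]]) (use 5 ge in auto)
  next
    case 6
    show ?thesis
      by (rule admissible_mono[OF admissible_antidiagonal[of \<alpha>]]) (use 6 \<alpha> ge in auto)
  qed
qed

section \<open>Norms\<close>

lemma enn2real_exponent:
  fixes u :: ennreal
  assumes "1 \<le> u" "u \<noteq> \<infinity>"
  shows "1 \<le> enn2real u" "enn2real (1 / u) = 1 / enn2real u"
proof -
  obtain r where r: "u = ennreal r" "r \<ge> 0" using assms(2) by (cases u) auto
  then have "1 \<le> r" using assms(1) by (simp flip: ennreal_1)
  then show "1 \<le> enn2real u" "enn2real (1 / u) = 1 / enn2real u"
    unfolding r(1) by (simp_all add: divide_ennreal flip: ennreal_1)
qed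

lemma enn2real_exponent_infinity: "enn2real (1 / \<infinity>) = 0"
  by simp

lemma enn2real_exponent_bounds:
  fixes u :: ennreal
  assumes "1 \<le> u"
  shows "0 \<le> enn2real (1 / u)" "enn2real (1 / u) \<le> 1"
  using enn2real_exponent[OF assms] enn2real_exponent_infinity by (cases "u = \<infinity>"; simp)+

lemma lp_norm_nonneg:
  assumes "finite P" "P \<noteq> {}"
  shows "0 \<le> lp_norm u P f"
proof -
  obtain p where p: "p \<in> P" using assms by blast
  have "0 \<le> cmod (f p)" by simp
  also have "\<dots> \<le> Max ((\<lambda>x. cmod (f x)) ` P)" using p assms by (intro Max_ge) auto
  finally show ?thesis by (simp add: lp_norm_def)
qed

text \<open>For finite u, \<phi> is the normalised density of |f|^u. It converts an arbitrary
  function into the normalised input of \<open>form_bound\<close>.\<close>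

lemma lp_norm_factor:
  fixes u :: ennreal and f :: "'i \<Rightarrow> complex"
  assumes u: "1 \<le> u" and P: "finite P" "P \<noteq> {}"
  obtains \<phi> where "\<And>p. 0 \<le> \<phi> p" "sum \<phi> P \<le> 1"
    "\<And>p. p \<in> P \<Longrightarrow> cmod (f p) \<le> lp_norm u P f * \<phi> p powr enn2real (1 / u)"
proof (cases "u = \<infinity>")
  case True
  have N: "card P > 0" using P by (simp add: card_gt_0_iff)
  show thesis
  proof (rule that)
    \<comment> \<open>Any everywhere positive weight works: its power with exponent 0 must be 1, not
      the default value 0 at a zero base.\<close>
    show "0 \<le> 1 / real (card P)" by simp
    show "(\<Sum>p\<in>P. 1 / real (card P)) \<le> 1" using N by simp
    fix p assume "p \<in> P"
    then show "cmod (f p) \<le> lp_norm u P f * (1 / real (card P)) powr enn2real (1 / u)"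
      using P N True by (simp add: lp_norm_def)
  qed
next
  case False
  define r where "r = enn2real u"
  have r: "1 \<le> r" "enn2real (1 / u) = 1 / r" using enn2real_exponent[OF u False] by (simp_all add: r_def)
  define S where "S = (\<Sum>p\<in>P. cmod (f p) powr r)"
  have S0: "S \<ge> 0" by (simp add: S_def sum_nonneg)
  have N: "lp_norm u P f = S powr (1 / r)" using False by (simp add: lp_norm_def S_def r_def)
  show thesis
  proof (rule that)
    show "0 \<le> cmod (f p) powr r / S" for p using S0 by simp
    show "(\<Sum>p\<in>P. cmod (f p) powr r / S) \<le> 1"
      using S0 by (simp add: sum_divide_distrib[symmetric] S_def[symmetric])
    fix p assume p: "p \<in> P"
    show "cmod (f p) \<le> lp_norm u P f * (cmod (f p) powr r / S) powr enn2real (1 / u)"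
    proof (cases "S = 0")
      \<comment> \<open>Division by zero makes \<phi> vanish here; the norm is 0 and so is
        \<open>f\<close> on \<open>P\<close>.\<close>
      case True
      then have "cmod (f p) powr r = 0"
        using P p unfolding S_def by (subst (asm) sum_nonneg_eq_0_iff) auto
      then show ?thesis by simp
    next
      case False
      then show ?thesis using S0 r unfolding N by (simp add: powr_divide powr_powr)
    qed
  qed
qed

text \<open>The weight is the extremiser of Hoelder's inequality: the normalised r-th power of
  \<open>g\<close> for finite v = r, and the point mass at a maximum of \<open>g\<close> for v =
  \<infinity>.\<close>

lemma lp_norm_dual:
  fixes v :: ennreal and g :: "'i \<Rightarrow> real"
  assumes v: "1 \<le> v" and D: "finite D" "D \<noteq> {}" and g: "\<And>\<omega>. \<omega> \<in> D \<Longrightarrow> 0 \<le> g \<omega>"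
  obtains \<psi> where "\<And>\<omega>. 0 \<le> \<psi> \<omega>" "sum \<psi> D \<le> 1"
    "lp_norm v D (\<lambda>\<omega>. complex_of_real (g \<omega>)) \<le> (\<Sum>\<omega>\<in>D. g \<omega> * \<psi> \<omega> powr (1 - enn2real (1 / v)))"
proof (cases "v = \<infinity>")
  case True
  have "Max ((\<lambda>\<omega>. cmod (complex_of_real (g \<omega>))) ` D) \<in> (\<lambda>\<omega>. cmod (complex_of_real (g \<omega>))) ` D"
    using D by (intro Max_in) auto
  then obtain \<eta> where \<eta>: "\<eta> \<in> D" "lp_norm v D (\<lambda>\<omega>. complex_of_real (g \<omega>)) = g \<eta>"
    using True g by (auto simp: lp_norm_def)
  show thesis
  proof (rule that)
    show "0 \<le> (if \<omega> = \<eta> then 1 else 0 :: real)" for \<omega> by simp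
    show "(\<Sum>\<omega>\<in>D. if \<omega> = \<eta> then 1 else 0 :: real) \<le> 1" using D by simp
    have "(\<Sum>\<omega>\<in>D. g \<omega> * (if \<omega> = \<eta> then 1 else 0) powr (1 - enn2real (1 / v)))
        = (\<Sum>\<omega>\<in>D. if \<omega> = \<eta> then g \<omega> else 0)"
      using True by (intro sum.cong) auto
    then show "lp_norm v D (\<lambda>\<omega>. complex_of_real (g \<omega>))
        \<le> (\<Sum>\<omega>\<in>D. g \<omega> * (if \<omega> = \<eta> then 1 else 0) powr (1 - enn2real (1 / v)))"
      using \<eta> D by simp
  qed
next
  case False
  define r where "r = enn2real v"
  have r: "1 \<le> r" "enn2real (1 / v) = 1 / r" using enn2real_exponent[OF v False] by (simp_all add: r_def)
  define W where "W = (\<Sum>\<omega>\<in>D. g \<omega> powr r)"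
  have W0: "W \<ge> 0" by (simp add: W_def sum_nonneg)
  have N: "lp_norm v D (\<lambda>\<omega>. complex_of_real (g \<omega>)) = W powr (1 / r)"
    using False g by (simp add: lp_norm_def W_def r_def)
  show thesis
  proof (rule that)
    show "0 \<le> g \<omega> powr r / W" for \<omega> using W0 by simp
    show "(\<Sum>\<omega>\<in>D. g \<omega> powr r / W) \<le> 1"
      using W0 by (simp add: sum_divide_distrib[symmetric] W_def[symmetric])
    have "(\<Sum>\<omega>\<in>D. g \<omega> * (g \<omega> powr r / W) powr (1 - 1 / r)) = (\<Sum>\<omega>\<in>D. g \<omega> powr r / W powr (1 - 1 / r))"
    proof (rule sum.cong[OF refl])
      fix \<omega> assume "\<omega> \<in> D"
      then have "g \<omega> * g \<omega> powr (r * (1 - 1 / r)) = g \<omega> powr r"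
        using g[of \<omega>] r by (cases "g \<omega> = 0") (simp_all add: powr_mult_base algebra_simps)
      then show "g \<omega> * (g \<omega> powr r / W) powr (1 - 1 / r) = g \<omega> powr r / W powr (1 - 1 / r)"
        using W0 by (simp add: powr_divide powr_powr)
    qed
    also have "\<dots> = W / W powr (1 - 1 / r)"
      by (simp add: sum_divide_distrib[symmetric] W_def[symmetric])
    also have "\<dots> = W powr (1 / r)"
      using W0 by (cases "W = 0") (simp_all add: powr_diff)
    finally show "lp_norm v D (\<lambda>\<omega>. complex_of_real (g \<omega>))
        \<le> (\<Sum>\<omega>\<in>D. g \<omega> * (g \<omega> powr r / W) powr (1 - enn2real (1 / v)))"
      unfolding N r(2) by simp
  qed
qed

text \<open>Chebyshev's inequality, in the form that turns many directions with a rich line into a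
  large norm.\<close>

lemma lp_norm_ge:
  fixes v :: ennreal and g :: "'i \<Rightarrow> real"
  assumes v: "1 \<le> v" and D: "finite D" and S: "S \<subseteq> D" "S \<noteq> {}"
    and m: "0 \<le> m" "\<And>\<omega>. \<omega> \<in> S \<Longrightarrow> m \<le> g \<omega>"
  shows "m * real (card S) powr enn2real (1 / v) \<le> lp_norm v D (\<lambda>\<omega>. complex_of_real (g \<omega>))"
proof (cases "v = \<infinity>")
  case True
  obtain \<omega> where \<omega>: "\<omega> \<in> S" using S by blast
  have "m \<le> cmod (complex_of_real (g \<omega>))" using m(2)[OF \<omega>] by simp
  also have "\<dots> \<le> Max ((\<lambda>\<omega>. cmod (complex_of_real (g \<omega>))) ` D)"
    using S \<omega> D by (intro Max_ge) auto
  finally show ?thesis using True m S finite_subset[OF S(1) D] by (simp add: lp_norm_def card_gt_0_iff)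
next
  case False
  define r where "r = enn2real v"
  have r: "1 \<le> r" "enn2real (1 / v) = 1 / r" using enn2real_exponent[OF v False] by (simp_all add: r_def)
  have "m powr r * real (card S) = (\<Sum>\<omega>\<in>S. m powr r)" by simp
  also have "\<dots> \<le> (\<Sum>\<omega>\<in>S. \<bar>g \<omega>\<bar> powr r)"
    using m r by (intro sum_mono powr_mono2) (auto intro: order.trans[OF m(2)])
  also have "\<dots> \<le> (\<Sum>\<omega>\<in>D. \<bar>g \<omega>\<bar> powr r)"
    using S D by (intro sum_mono2) auto
  finally have "(m powr r * real (card S)) powr (1 / r) \<le> (\<Sum>\<omega>\<in>D. \<bar>g \<omega>\<bar> powr r) powr (1 / r)"
    using r by (intro powr_mono2) auto
  moreover have "(m powr r * real (card S)) powr (1 / r) = m * real (card S) powr (1 / r)"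
    using m r by (simp add: powr_mult powr_powr)
  ultimately show ?thesis using False r by (simp add: lp_norm_def r_def)
qed

lemma lp_norm_indicator:
  fixes u :: ennreal
  assumes u: "1 \<le> u" and P: "finite P" and X: "X \<subseteq> P" "X \<noteq> {}"
  shows "lp_norm u P (\<lambda>p. if p \<in> X then 1 else 0) = real (card X) powr enn2real (1 / u)"
proof (cases "u = \<infinity>")
  case True
  have "Max ((\<lambda>x. cmod (if x \<in> X then 1 else 0)) ` P) = 1"
    using P X by (intro Max_eqI) (auto split: if_splits)
  then show ?thesis using True X finite_subset[OF X(1) P] by (simp add: lp_norm_def card_gt_0_iff)
next
  case False
  define r where "r = enn2real u"
  have r: "1 \<le> r" "enn2real (1 / u) = 1 / r" using enn2real_exponent[OF u False] by (simp_all add: r_def)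
  have "(\<Sum>p\<in>P. cmod (if p \<in> X then 1 else 0) powr r) = (\<Sum>p\<in>P. if p \<in> X then 1 else 0)"
    by (intro sum.cong) auto
  also have "\<dots> = real (card X)"
    using P X by (simp add: sum.inter_restrict[symmetric] Int_absorb1)
  finally show ?thesis using False r by (simp add: lp_norm_def r_def)
qed

section \<open>The upper bound\<close>

context finite_field
begin

lemma H_nonempty: "H \<noteq> {}" by blast

lemma finite_line_sums: "finite {(\<Sum>p\<in>l. cmod (F p)) | l. l \<in> horizontal_lines R \<and> Dir R l = \<omega>}"
proof -
  have "finite (horizontal_lines R)"
  proof (rule finite_subset)
    show "horizontal_lines R \<subseteq> Pow H" by (intro subsetI PowI horizontal_line_subset)
    show "finite (Pow H)" by simp
  qed
  then have "finite ((\<lambda>l. \<Sum>p\<in>l. cmod (F p)) ` horizontal_lines R)" by blast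
  then show ?thesis by (rule rev_finite_subset) blast
qed

lemma maximal_rd_ge:
  assumes "l \<in> horizontal_lines R" "Dir R l = \<omega>"
  shows "(\<Sum>p\<in>l. cmod (F p)) \<le> maximal_rd R F \<omega>"
  unfolding maximal_rd_def using assms by (intro Max_ge finite_line_sums) blast

lemma maximal_rd_attained:
  assumes "\<omega> \<in> \<D>"
  shows "\<exists>l\<in>horizontal_lines R. Dir R l = \<omega> \<and> maximal_rd R F \<omega> = (\<Sum>p\<in>l. cmod (F p))"
proof -
  have "maximal_rd R F \<omega> \<in> {(\<Sum>p\<in>l. cmod (F p)) | l. l \<in> horizontal_lines R \<and> Dir R l = \<omega>}"
    unfolding maximal_rd_def using direction_has_line[OF assms] by (intro Max_in finite_line_sums) blast
  then show ?thesis by blast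
qed

lemma maximal_rd_line_choice:
  obtains L where "line_choice R L" "\<And>\<omega>. \<omega> \<in> \<D> \<Longrightarrow> maximal_rd R F \<omega> = (\<Sum>p\<in>L \<omega>. cmod (F p))"
proof -
  let ?Q = "\<lambda>\<omega> l. l \<in> horizontal_lines R \<and> Dir R l = \<omega> \<and> maximal_rd R F \<omega> = (\<Sum>p\<in>l. cmod (F p))"
  define L where "L \<omega> = (SOME l. ?Q \<omega> l)" for \<omega>
  have L: "?Q \<omega> (L \<omega>)" if "\<omega> \<in> \<D>" for \<omega>
    unfolding L_def by (rule someI_ex) (use maximal_rd_attained[OF that, of F] in \<open>simp only: Bex_def\<close>)
  show thesis
  proof (rule that[of L])
    show "line_choice R L" by unfold_locales (simp_all add: L)
  qed (simp add: L)
qed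

end

text \<open>The lines attaining the maxima for \<open>F\<close> form one admissible selector.
  Factoring out the norm of \<open>F\<close> and dualising the l^v norm then leaves exactly the
  bilinear form with normalised weights.\<close>

lemma rd_bound_if_admissible:
  fixes u v :: ennreal
  assumes u: "1 \<le> u" and v: "1 \<le> v"
    and adm: "admissible (enn2real (1 / u)) (enn2real (1 / v)) A"
  shows "rd_bound u v A"
proof -
  let ?\<alpha> = "enn2real (1 / u)" and ?\<beta> = "enn2real (1 / v)"
  obtain C where C: "C > 0" and
    bnd: "\<And>(R :: nat ring) L. line_choice R L \<Longrightarrow>
      form_bound (refined_directions R) (carrier R \<times> carrier R \<times> carrier R) L ?\<alpha> (1 - ?\<beta>)
        (C * real (card (carrier R)) powr A)"
    using adm unfolding admissible_def by blast
  have "lp_norm v (refined_directions R) (\<lambda>\<omega>. complex_of_real (maximal_rd R F \<omega>))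
      \<le> C * real (card (carrier R)) powr A * lp_norm u (carrier (heis R)) F"
    if R: "field R" "finite (carrier R)" for R :: "nat ring" and F
  proof -
    interpret finite_field R using R by (simp add: finite_field_def finite_field_axioms_def)
    obtain L where lc: "line_choice R L"
      and M: "\<And>\<omega>. \<omega> \<in> \<D> \<Longrightarrow> maximal_rd R F \<omega> = (\<Sum>p\<in>L \<omega>. cmod (F p))"
      using maximal_rd_line_choice[of F] by blast
    interpret line_choice R L by (rule lc)
    let ?N = "lp_norm u H F"
    have N: "0 \<le> ?N" using H_nonempty by (intro lp_norm_nonneg) auto
    obtain \<phi> where \<phi>: "\<And>p. 0 \<le> \<phi> p" "sum \<phi> H \<le> 1"
      and F: "\<And>p. p \<in> H \<Longrightarrow> cmod (F p) \<le> ?N * \<phi> p powr ?\<alpha>"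
      using lp_norm_factor[OF u _ H_nonempty, of F] by blast
    have nonneg: "0 \<le> maximal_rd R F \<omega>" if "\<omega> \<in> \<D>" for \<omega>
      using that by (simp add: M sum_nonneg)
    obtain \<psi> where \<psi>: "\<And>\<omega>. 0 \<le> \<psi> \<omega>" "sum \<psi> \<D> \<le> 1"
      and dual: "lp_norm v \<D> (\<lambda>\<omega>. complex_of_real (maximal_rd R F \<omega>))
        \<le> (\<Sum>\<omega>\<in>\<D>. maximal_rd R F \<omega> * \<psi> \<omega> powr (1 - ?\<beta>))"
      using lp_norm_dual[of v \<D> "maximal_rd R F", OF v finite_directions directions_nonempty nonneg] by blast
    note dual
    also have "(\<Sum>\<omega>\<in>\<D>. maximal_rd R F \<omega> * \<psi> \<omega> powr (1 - ?\<beta>))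
        = (\<Sum>\<omega>\<in>\<D>. \<Sum>p\<in>L \<omega>. cmod (F p) * \<psi> \<omega> powr (1 - ?\<beta>))"
      by (simp add: M sum_distrib_right)
    also have "\<dots> \<le> (\<Sum>\<omega>\<in>\<D>. \<Sum>p\<in>L \<omega>. ?N * \<phi> p powr ?\<alpha> * \<psi> \<omega> powr (1 - ?\<beta>))"
      using F subsetD[OF L_subset] by (intro sum_mono mult_right_mono) auto
    also have "\<dots> = ?N * (\<Sum>\<omega>\<in>\<D>. \<Sum>p\<in>L \<omega>. \<phi> p powr ?\<alpha> * \<psi> \<omega> powr (1 - ?\<beta>))"
      by (simp add: sum_distrib_left mult.assoc)
    also have "\<dots> \<le> ?N * (C * real q powr A)"
      using N by (intro mult_left_mono form_boundD[OF bnd[OF lc] \<phi>(1) \<psi>(1) \<phi>(2) \<psi>(2)])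
    finally show ?thesis by (simp add: carrier_heis mult_ac)
  qed
  then show ?thesis unfolding rd_bound_def using C by blast
qed

section \<open>The lower bound\<close>

context finite_field
begin

lemma card_hline:
  assumes "p \<in> H" "(a, b) \<in> NZ"
  shows "card (hline R p a b) = q"
proof -
  have K: "a \<in> carrier R" "b \<in> carrier R" using assms by (auto simp: NZ_iff)
  show ?thesis unfolding hline_hstep[OF assms(1) K] by (rule card_image[OF inj_hstep_line[OF assms]])
qed

lemma maximal_rd_indicator_ge:
  assumes "l \<in> horizontal_lines R" "Dir R l = \<omega>" "Y \<subseteq> l" "Y \<subseteq> X"
  shows "real (card Y) \<le> maximal_rd R (\<lambda>p. if p \<in> X then 1 else 0) \<omega>"
proof -
  have fin: "finite l" by (rule finite_subset[OF horizontal_line_subset[OF assms(1)]]) auto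
  have "(\<Sum>p\<in>Y. cmod (if p \<in> X then 1 else 0)) = (\<Sum>p\<in>Y. 1)"
    using subsetD[OF assms(4)] by (intro sum.cong refl) simp
  then have "real (card Y) = (\<Sum>p\<in>Y. cmod (if p \<in> X then 1 else 0))" by simp
  also have "\<dots> \<le> (\<Sum>p\<in>l. cmod (if p \<in> X then 1 else 0))"
    using fin assms(3) by (intro sum_mono2) auto
  also have "\<dots> \<le> maximal_rd R (\<lambda>p. if p \<in> X then 1 else 0) \<omega>"
    by (rule maximal_rd_ge[OF assms(1,2)])
  finally show ?thesis .
qed

text \<open>Only three numbers enter a counterexample: the size of the test set, the number of
  directions that see it, and the number of points seen on each line.\<close>

lemma indicator_test:
  fixes u v :: ennreal
  assumes u: "1 \<le> u" and v: "1 \<le> v"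
    and bound: "\<And>F. lp_norm v \<D> (\<lambda>\<omega>. complex_of_real (maximal_rd R F \<omega>)) \<le> B * lp_norm u (carrier (heis R)) F"
    and X: "X \<subseteq> H" "X \<noteq> {}" and S: "S \<subseteq> \<D>" "S \<noteq> {}"
    and hit: "\<And>\<omega>. \<omega> \<in> S \<Longrightarrow> \<exists>l\<in>horizontal_lines R. Dir R l = \<omega> \<and> m \<le> card (l \<inter> X)"
  shows "real m * real (card S) powr enn2real (1 / v) \<le> B * real (card X) powr enn2real (1 / u)"
proof -
  let ?F = "\<lambda>p. if p \<in> X then 1 else 0 :: complex"
  have "real m \<le> maximal_rd R ?F \<omega>" if \<omega>: "\<omega> \<in> S" for \<omega>
  proof -
    obtain l where l: "l \<in> horizontal_lines R" "Dir R l = \<omega>" "m \<le> card (l \<inter> X)"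
      using hit[OF \<omega>] by blast
    then show ?thesis using maximal_rd_indicator_ge[OF l(1,2), of "l \<inter> X" X] by force
  qed
  then have "real m * real (card S) powr enn2real (1 / v)
      \<le> lp_norm v \<D> (\<lambda>\<omega>. complex_of_real (maximal_rd R ?F \<omega>))"
    by (intro lp_norm_ge[OF v finite_directions S]) auto
  also have "\<dots> \<le> B * lp_norm u (carrier (heis R)) ?F" by (rule bound)
  also have "lp_norm u (carrier (heis R)) ?F = real (card X) powr enn2real (1 / u)"
    unfolding carrier_heis using X by (intro lp_norm_indicator[OF u]) auto
  finally show ?thesis .
qed

lemma proj_point_slope_inj:
  assumes "a \<in> carrier R" "c \<in> carrier R" "a' \<in> carrier R" "c' \<in> carrier R"
    and eq: "proj_point R a \<one> c = proj_point R a' \<one> c'"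
  shows "a = a'" "c = c'"
proof -
  have "(a', \<one>, c') \<in> nonzero_triples R" using assms by (auto simp: nonzero_triples_def)
  then have "((a, \<one>, c), (a', \<one>, c')) \<in> proj_rel R"
    using eq eq_equiv_class[OF _ equiv_proj_rel] unfolding proj_point_def by blast
  then obtain r where r: "r \<in> carrier R" "a' = r \<otimes> a" "\<one> = r \<otimes> \<one>" "c' = r \<otimes> c"
    unfolding proj_rel_def by blast
  then have "r = \<one>" by simp
  then show "a = a'" "c = c'" using r assms by auto
qed

text \<open>A base point on the x-axis with b = 1 makes the third direction coordinate equal to
  \<open>c\<close>. These lines realise all directions [a : 1 : c] and all meet one common
  horizontal line.\<close>

definition slope_line :: "'a \<Rightarrow> 'a \<Rightarrow> ('a \<times> 'a \<times> 'a) set" where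
  "slope_line a c = hline R (c, \<zero>, \<zero>) a \<one>"

lemma slope_line:
  assumes "a \<in> carrier R" "c \<in> carrier R"
  shows "slope_line a c \<in> horizontal_lines R" "Dir R (slope_line a c) = proj_point R a \<one> c"
    "proj_point R a \<one> c \<in> \<D>" "card (slope_line a c) = q" "(c, \<zero>, \<zero>) \<in> slope_line a c"
    "slope_line a c \<subseteq> H"
proof -
  have p: "(c, \<zero>, \<zero>) \<in> H" and w: "(a, \<one>) \<in> NZ" using assms by (auto simp: NZ_iff)
  show l: "slope_line a c \<in> horizontal_lines R"
    unfolding slope_line_def horizontal_lines_iff using p w by blast
  have d: "direction (c, \<zero>, \<zero>) a \<one> = proj_point R a \<one> c"
    using assms by (simp add: direction_def minus_eq)
  show "Dir R (slope_line a c) = proj_point R a \<one> c"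
    unfolding slope_line_def Dir_hline_direction[OF p w] by (rule d)
  show "proj_point R a \<one> c \<in> \<D>" using direction_mem[OF p w] unfolding d .
  show "card (slope_line a c) = q" unfolding slope_line_def by (rule card_hline[OF p w])
  have "(c, \<zero>, \<zero>) = hstep (\<zero> \<otimes> a) (\<zero> \<otimes> \<one>) (c, \<zero>, \<zero>)"
    using hstep_0[OF p] assms by simp
  then show "(c, \<zero>, \<zero>) \<in> slope_line a c"
    unfolding slope_line_def hline_hstep[OF p assms(1) one_closed] by blast
  show "slope_line a c \<subseteq> H" by (rule horizontal_line_subset[OF l])
qed

lemma lower_bounds:
  fixes u v :: ennreal
  assumes u: "1 \<le> u" and v: "1 \<le> v"
    and bound: "\<And>F. lp_norm v \<D> (\<lambda>\<omega>. complex_of_real (maximal_rd R F \<omega>)) \<le> B * lp_norm u (carrier (heis R)) F"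
  shows "real q powr enn2real (1 / v) \<le> B"
    and "real q \<le> B * real q powr enn2real (1 / u)"
    and "real q powr (2 * enn2real (1 / v)) \<le> B * real q powr enn2real (1 / u)"
    and "real q * real q powr (2 * enn2real (1 / v)) \<le> B * real q powr (3 * enn2real (1 / u))"
proof -
  note test = indicator_test[OF u v bound]
  let ?K = "carrier R"
  \<comment> \<open>The chart b = 1 already contains q^2 directions, the full order of
    magnitude.\<close>
  define S where "S = (\<lambda>(a, c). proj_point R a \<one> c) ` (?K \<times> ?K)"
  have "inj_on (\<lambda>(a, c). proj_point R a \<one> c) (?K \<times> ?K)"
  proof (rule inj_onI)
    fix z z' assume z: "z \<in> ?K \<times> ?K" "z' \<in> ?K \<times> ?K"
      "(case z of (a, c) \<Rightarrow> proj_point R a \<one> c) = (case z' of (a, c) \<Rightarrow> proj_point R a \<one> c)"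
    then have "fst z = fst z'" "snd z = snd z'"
      using proj_point_slope_inj[of "fst z" "snd z" "fst z'" "snd z'"]
      by (simp_all add: case_prod_unfold mem_Times_iff)
    then show "z = z'" by (rule prod_eqI)
  qed
  then have card_S: "card S = q ^ 2"
    by (simp add: S_def card_image card_cartesian_product power2_eq_square)
  have S: "S \<subseteq> \<D>" "S \<noteq> {}" using slope_line(3) by (auto simp: S_def)
  have powr2: "real (q ^ 2) powr e = real q powr (2 * e)" for e
    using q_pos by (simp add: powr_powr flip: powr_numeral)
  have powr3: "real (q ^ 3) powr e = real q powr (3 * e)" for e
    using q_pos by (simp add: powr_powr flip: powr_numeral)
  have pt_sub: "card (l \<inter> X) \<ge> 1" if "z \<in> l" "z \<in> X" "X \<subseteq> H" for l X and z :: "'a \<times> 'a \<times> 'a"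
  proof -
    have "finite (l \<inter> X)" using that(3) by (intro finite_Int disjI2 finite_subset[of X H]) auto
    then have "card (l \<inter> X) > 0" using that by (auto simp: card_gt_0_iff)
    then show ?thesis by simp
  qed

  show "real q powr enn2real (1 / v) \<le> B"
  proof -
    \<comment> \<open>With c = 0 the lines pass through the origin, which gives q directions seeing
      a single point.\<close>
    define S\<^sub>0 where "S\<^sub>0 = (\<lambda>a. proj_point R a \<one> \<zero>) ` ?K"
    have "inj_on (\<lambda>a. proj_point R a \<one> \<zero>) ?K"
      by (rule inj_onI) (rule proj_point_slope_inj(1)[OF _ zero_closed _ zero_closed])
    then have "card S\<^sub>0 = q" by (simp add: S\<^sub>0_def card_image)
    moreover have "real 1 * real (card S\<^sub>0) powr enn2real (1 / v) \<le> B * real (card {(\<zero>, \<zero>, \<zero>)}) powr enn2real (1 / u)"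
    proof (rule test)
      show "S\<^sub>0 \<subseteq> \<D>" "S\<^sub>0 \<noteq> {}" using slope_line(3) by (auto simp: S\<^sub>0_def)
      fix \<omega> assume "\<omega> \<in> S\<^sub>0"
      then obtain a where a: "a \<in> ?K" "\<omega> = proj_point R a \<one> \<zero>" by (auto simp: S\<^sub>0_def)
      then show "\<exists>l\<in>horizontal_lines R. Dir R l = \<omega> \<and> 1 \<le> card (l \<inter> {(\<zero>, \<zero>, \<zero>)})"
        using slope_line(1,2,5)[of a \<zero>] by (intro bexI[of _ "slope_line a \<zero>"]) auto
    qed auto
    ultimately show ?thesis by simp
  qed
  \<comment> \<open>The x-axis. It is tested twice: as a line it has all its q points in its own
    direction, and as the set of base points it is met at least once in each of the q^2 directions
    of \<open>S\<close>.\<close>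
  define X where "X = hline R (\<zero>, \<zero>, \<zero>) \<one> \<zero>"
  have p: "(\<zero>, \<zero>, \<zero>) \<in> H" and w: "(\<one>, \<zero>) \<in> NZ" by (auto simp: NZ_iff)
  have card_X: "card X = q" unfolding X_def by (rule card_hline[OF p w])
  have X: "X \<in> horizontal_lines R" unfolding X_def horizontal_lines_iff using p w by blast
  have X_ne: "X \<noteq> {}" using card_X q_pos by auto
  have X_mem: "(c, \<zero>, \<zero>) \<in> X" if "c \<in> ?K" for c
  proof -
    have "(c, \<zero>, \<zero>) = hstep (c \<otimes> \<one>) (c \<otimes> \<zero>) (\<zero>, \<zero>, \<zero>)" using that by (simp add: hstep_def minus_eq)
    then show ?thesis using that unfolding X_def hline_hstep[OF p one_closed zero_closed] by blast
  qed
  have "real q * real (card {Dir R X}) powr enn2real (1 / v) \<le> B * real (card X) powr enn2real (1 / u)"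
  proof (rule test)
    show "X \<subseteq> H" by (rule horizontal_line_subset[OF X])
    show "{Dir R X} \<subseteq> \<D>" using direction_mem[OF p w] Dir_hline_direction[OF p w] by (simp add: X_def)
  qed (use X X_ne card_X in auto)
  then show "real q \<le> B * real q powr enn2real (1 / u)" by (simp add: card_X)
  have "real 1 * real (card S) powr enn2real (1 / v) \<le> B * real (card X) powr enn2real (1 / u)"
  proof (rule test)
    show XH: "X \<subseteq> H" by (rule horizontal_line_subset[OF X])
    fix \<omega> assume "\<omega> \<in> S"
    then obtain a c where ac: "a \<in> ?K" "c \<in> ?K" "\<omega> = proj_point R a \<one> c" by (auto simp: S_def)
    have "1 \<le> card (slope_line a c \<inter> X)"
      using slope_line(5)[OF ac(1,2)] X_mem[OF ac(2)] XH by (rule pt_sub)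
    then show "\<exists>l\<in>horizontal_lines R. Dir R l = \<omega> \<and> 1 \<le> card (l \<inter> X)"
      using slope_line(1,2)[OF ac(1,2)] ac(3) by blast
  qed (use X_ne S in auto)
  then show "real q powr (2 * enn2real (1 / v)) \<le> B * real q powr enn2real (1 / u)"
    by (simp only: card_X card_S powr2 of_nat_1 mult_1)
  have "real q * real (card S) powr enn2real (1 / v) \<le> B * real (card H) powr enn2real (1 / u)"
  proof (rule test)
    fix \<omega> assume "\<omega> \<in> S"
    then obtain a c where ac: "a \<in> ?K" "c \<in> ?K" "\<omega> = proj_point R a \<one> c" by (auto simp: S_def)
    have "slope_line a c \<inter> H = slope_line a c" using slope_line(6)[OF ac(1,2)] by blast
    then show "\<exists>l\<in>horizontal_lines R. Dir R l = \<omega> \<and> q \<le> card (l \<inter> H)"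
      using slope_line(1,2,4)[OF ac(1,2)] ac(3) by (intro bexI[of _ "slope_line a c"]) auto
  qed (use S H_nonempty in auto)
  moreover have "card H = q ^ 3" by (simp add: card_cartesian_product power3_eq_cube)
  ultimately show "real q * real q powr (2 * enn2real (1 / v)) \<le> B * real q powr (3 * enn2real (1 / u))"
    by (simp only: card_S powr2 powr3)
qed

end

text \<open>Residues are integers, so the field is transported to a carrier in \<open>nat\<close>,
  over which \<open>rd_bound\<close> quantifies. Prime fields provide arbitrarily large q for the
  lower bound.\<close>

lemma exists_nat_prime_field:
  assumes "prime p"
  shows "\<exists>R :: nat ring. field R \<and> finite (carrier R) \<and> card (carrier R) = p"
proof -
  interpret residues_prime p "residue_ring (int p)" by unfold_locales (use assms in auto)
  have fin: "finite (carrier (residue_ring (int p)))" by (simp add: res_carrier_eq)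
  obtain S :: "nat ring" where S: "field S" "residue_ring (int p) \<simeq> S"
    using finite_field_nat_copy[OF is_field fin] by blast
  then obtain f where "f \<in> ring_iso (residue_ring (int p)) S"
    unfolding is_ring_iso_def by blast
  then have bij: "bij_betw f (carrier (residue_ring (int p))) (carrier S)"
    by (simp add: ring_iso_def)
  have "card (carrier (residue_ring (int p))) = p" by (simp add: res_carrier_eq)
  then show ?thesis
    using S(1) bij_betw_same_card[OF bij] bij_betw_finite[OF bij] fin by auto
qed

lemma exponent_le_if_primes:
  fixes C e A :: real
  assumes le: "\<And>p::nat. prime p \<Longrightarrow> odd p \<Longrightarrow> real p powr e \<le> C * real p powr A"
  shows "e \<le> A"
proof (rule ccontr)
  assume "\<not> e \<le> A"
  then have pos: "e - A > 0" by simp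
  \<comment> \<open>Chosen so that p \<ge> N forces p^(e - A) \<ge> |C| + 1, contradicting the bound
    by \<open>C\<close>.\<close>
  define N where "N = nat \<lceil>(\<bar>C\<bar> + 1) powr (1 / (e - A))\<rceil>"
  \<comment> \<open>The added 2 makes the prime odd.\<close>
  obtain p where p: "prime p" "p > N + 2" using bigger_prime by blast
  have "odd p" using p prime_odd_nat by auto
  have p0: "real p > 0" using p by simp
  have "(\<bar>C\<bar> + 1) powr (1 / (e - A)) \<le> real N" unfolding N_def by linarith
  also have "\<dots> \<le> real p" using p by simp
  finally have "((\<bar>C\<bar> + 1) powr (1 / (e - A))) powr (e - A) \<le> real p powr (e - A)"
    using pos by (intro powr_mono2) auto
  then have "\<bar>C\<bar> + 1 \<le> real p powr (e - A)" using pos by (simp add: powr_powr)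
  also have "real p powr (e - A) \<le> C"
    using le[OF p(1) \<open>odd p\<close>] p0 by (simp add: powr_diff divide_le_eq)
  finally show False by linarith
qed

lemma rd_exponent_le_if_rd_bound:
  fixes u v :: ennreal
  assumes u: "1 \<le> u" and v: "1 \<le> v" and bnd: "rd_bound u v A"
  shows "rd_exponent (enn2real (1 / u)) (enn2real (1 / v)) \<le> A"
proof -
  let ?\<alpha> = "enn2real (1 / u)" and ?\<beta> = "enn2real (1 / v)"
  obtain C where bound: "\<And>q (R :: nat ring) F. primepow q \<Longrightarrow> odd q \<Longrightarrow> field R \<Longrightarrow>
      finite (carrier R) \<Longrightarrow> card (carrier R) = q \<Longrightarrow>
      lp_norm v (refined_directions R) (\<lambda>\<omega>. complex_of_real (maximal_rd R F \<omega>))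
        \<le> C * real q powr A * lp_norm u (carrier (heis R)) F"
    using bnd unfolding rd_bound_def by blast
  have lower: "real p powr ?\<beta> \<le> C * real p powr A"
    "real p powr 1 \<le> C * real p powr (A + ?\<alpha>)"
    "real p powr (2 * ?\<beta>) \<le> C * real p powr (A + ?\<alpha>)"
    "real p powr (1 + 2 * ?\<beta>) \<le> C * real p powr (A + 3 * ?\<alpha>)"
    if p: "prime p" "odd p" for p
  proof -
    obtain R :: "nat ring" where R: "field R" "finite (carrier R)" "card (carrier R) = p"
      using exists_nat_prime_field[OF p(1)] by blast
    interpret finite_field R using R by (simp add: finite_field_def finite_field_axioms_def)
    have p0: "real p > 0" using q_pos R(3) by simp
    note lb = lower_bounds[OF u v bound[OF primepow_prime[OF p(1)] p(2) R], unfolded R(3)]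
    show "real p powr ?\<beta> \<le> C * real p powr A" by (rule lb(1))
    show "real p powr 1 \<le> C * real p powr (A + ?\<alpha>)" using lb(2) p0 by (simp add: powr_add mult.assoc)
    show "real p powr (2 * ?\<beta>) \<le> C * real p powr (A + ?\<alpha>)" using lb(3) by (simp add: powr_add mult.assoc)
    show "real p powr (1 + 2 * ?\<beta>) \<le> C * real p powr (A + 3 * ?\<alpha>)"
      using lb(4) p0 by (simp add: powr_add mult.assoc)
  qed
  have "?\<beta> \<le> A" by (rule exponent_le_if_primes) (rule lower(1))
  moreover have "1 \<le> A + ?\<alpha>" by (rule exponent_le_if_primes) (rule lower(2))
  moreover have "2 * ?\<beta> \<le> A + ?\<alpha>" by (rule exponent_le_if_primes) (rule lower(3))
  moreover have "1 + 2 * ?\<beta> \<le> A + 3 * ?\<alpha>" by (rule exponent_le_if_primes) (rule lower(4))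
  ultimately show ?thesis by (simp add: rd_exponent_def)
qed

theorem theorem1p7:
  fixes u v :: ennreal
  assumes "1 \<le> u" and "1 \<le> v"
  shows "(0 \<le> A_rd u v \<and> rd_bound u v (A_rd u v) \<and>
          (\<forall>A. 0 \<le> A \<and> rd_bound u v A \<longrightarrow> A_rd u v \<le> A)) \<and>
         A_rd u v = Max {enn2real (1 / v), 1 - enn2real (1 / u),
                         2 * enn2real (1 / v) - enn2real (1 / u),
                         1 + 2 * enn2real (1 / v) - 3 * enn2real (1 / u)}"
proof -
  let ?E = "rd_exponent (enn2real (1 / u)) (enn2real (1 / v))"
  \<comment> \<open>The upper bound holds at the critical exponent itself, without an arbitrarily
    small loss, so the set of admissible exponents has a least element.\<close>
  have "rd_bound u v ?E"
    using assms by (intro rd_bound_if_admissible admissible_rd_exponent enn2real_exponent_bounds)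
  moreover have "0 \<le> ?E"
    using rd_exponent_ge(1) enn2real_exponent_bounds(1)[OF assms(2)] order.trans by blast
  moreover have least: "?E \<le> A" if "rd_bound u v A" for A
    using rd_exponent_le_if_rd_bound[OF assms that] .
  ultimately have eq: "A_rd u v = ?E"
    unfolding A_rd_def by (intro Least_equality) auto
  show ?thesis
  proof (intro conjI allI impI)
    show "0 \<le> A_rd u v" unfolding eq by fact
    show "rd_bound u v (A_rd u v)" unfolding eq by fact
    show "A_rd u v \<le> A" if "0 \<le> A \<and> rd_bound u v A" for A
      unfolding eq using that least by blast
  qed (simp only: eq rd_exponent_def)
qed

end
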